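(* Let $k$ be an algebraically closed field of characteristic $p\ge3$, let $(\mathfrak{g},[p])$ be a finite-dimensional restricted Lie algebra over $k$, let $\mathfrak{t}\subseteq\mathfrak{g}$ be a torus of maximal dimension, and let $M=\bigoplus_{\lambda\in\Lambda_M}M_\lambda$ be a finite-dimensional restricted $\mathfrak{g}$-module, decomposed into weight spaces relative to $\mathfrak{t}$. If the variety $\mathcal{T}_{\mathfrak{g}}(k)$ is irreducible, then the following statements hold: (1) $\Lambda_M=\{0\}$, or $\Lambda_M$ contains $\mathrm{Lie}_p(\mathfrak{t},k)\setminus\{0\}$. (2) All weight spaces of $M$ belonging to non-zero weights have the same dimension.
   Context: A torus is an abelian $p$-subalgebra consisting of semisimple elements ($x$ is semisimple if it lies in the $p$-subalgebra generated by $x^{[p]}$); "maximal dimension" means dimension $\mu(\mathfrak{g})$, the maximum of the dimensions of all tori of $\mathfrak{g}$. A $\mathfrak{g}$-module $M$ is restricted if for every $x\in\mathfrak{g}$ the element $x^{[p]}$ acts on $M$ as the $p$-th power of the action of $x$. $M_\lambda=\{m\in M: t.m=\lambda(t)m\ \forall t\in\mathfrak{t}\}$ and $\Lambda_M=\{\lambda: M_\lambda\ne0\}$ is the set of weights. $\mathrm{Lie}_p(\mathfrak{t},k)$ is the additive group of homomorphisms $\mathfrak{t}\to k$ of restricted Lie algebras ($k$ with $p$-map $a\mapsto a^p$), i.e. linear forms with $\lambda(t^{[p]})=\lambda(t)^p$ for all $t\in\mathfrak{t}$; it contains $\Lambda_M$. $\mathcal{T}_{\mathfrak{g}}(k)$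 is the variety (with Zariski topology from $\mathrm{Hom}_k(\mathfrak{t},\mathfrak{g})$) of injective homomorphisms $\mathfrak{t}\to\mathfrak{g}$ of restricted Lie algebras.
   Formalization: Part (1) is stated for M ≠ 0: for the zero module the set of weights is empty, so (1) fails as written whenever the torus is non-zero (for example g = sl_2, p = 3, M = 0). *)

theory Defs
  imports
    "HOL-Analysis.Abstract_Topology"
    "HOL-Library.Function_Algebras"
    "HOL-Computational_Algebra.Computational_Algebra"
begin

section \<open>Zariski topology\<close>

definition irreducible_space :: "'a topology \<Rightarrow> bool" where
  "irreducible_space X \<longleftrightarrow> topspace X \<noteq> {} \<and>
     (\<forall>A B. closedin X A \<and> closedin X B \<and> A \<union> B = topspace X \<longrightarrow>
        A = topspace X \<or> B = topspace X)"

text \<open>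
  Linearity of a map on a subspace \<open>U\<close>; the behaviour outside \<open>U\<close> is unconstrained.
\<close>
definition linear_map_on ::
  "('k \<Rightarrow> 'a \<Rightarrow> 'a) \<Rightarrow> ('k \<Rightarrow> 'b \<Rightarrow> 'b) \<Rightarrow> 'a::plus set \<Rightarrow> ('a \<Rightarrow> 'b::plus) \<Rightarrow> bool" where
  "linear_map_on s1 s2 U f \<longleftrightarrow>
     (\<forall>x\<in>U. \<forall>y\<in>U. f (x + y) = f x + f y) \<and> (\<forall>c. \<forall>x\<in>U. f (s1 c x) = s2 c (f x))"

text \<open>
  The space of linear maps from a subspace \<open>U\<close> to a vector space. A map defined on \<open>U\<close> only is
  represented by its extension by \<open>0\<close>, so that equality of functions is equality on \<open>U\<close>
  and the vector space operations are the pointwise ones.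
\<close>
definition Hom_on ::
  "('k \<Rightarrow> 'a \<Rightarrow> 'a) \<Rightarrow> ('k \<Rightarrow> 'b \<Rightarrow> 'b) \<Rightarrow> 'a::plus set \<Rightarrow> ('a \<Rightarrow> 'b::{plus,zero}) set" where
  "Hom_on s1 s2 U = {f. linear_map_on s1 s2 U f \<and> (\<forall>x. x \<notin> U \<longrightarrow> f x = 0)}"

definition fun_scale :: "('k \<Rightarrow> 'b \<Rightarrow> 'b) \<Rightarrow> 'k \<Rightarrow> ('a \<Rightarrow> 'b) \<Rightarrow> 'a \<Rightarrow> 'b" where
  "fun_scale s c f = (\<lambda>x. s c (f x))"

text \<open>
  Polynomial functions on a finite-dimensional vector space \<open>V\<close>, without reference to a basis:
  the algebra of functions generated by the linear forms.
\<close>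
inductive_set polynomial_functions ::
    "('k::field \<Rightarrow> 'v::plus \<Rightarrow> 'v) \<Rightarrow> 'v set \<Rightarrow> ('v \<Rightarrow> 'k) set"
  for s :: "'k \<Rightarrow> 'v \<Rightarrow> 'v" and V :: "'v set" where
  const: "(\<lambda>_. c) \<in> polynomial_functions s V"
| linear: "linear_map_on s (*) V f \<Longrightarrow> f \<in> polynomial_functions s V"
| add: "f \<in> polynomial_functions s V \<Longrightarrow> g \<in> polynomial_functions s V \<Longrightarrow>
    (\<lambda>x. f x + g x) \<in> polynomial_functions s V"
| mult: "f \<in> polynomial_functions s V \<Longrightarrow> g \<in> polynomial_functions s V \<Longrightarrow>
    (\<lambda>x. f x * g x) \<in> polynomial_functions s V"

definition zero_set :: "'v set \<Rightarrow> ('v \<Rightarrow> 'k::zero) set \<Rightarrow> 'v set" where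
  "zero_set V F = {v \<in> V. \<forall>f\<in>F. f v = 0}"

definition zariski_topology :: "('k::field \<Rightarrow> 'v::plus \<Rightarrow> 'v) \<Rightarrow> 'v set \<Rightarrow> 'v topology" where
  "zariski_topology s V =
     topology (\<lambda>U. \<exists>F \<subseteq> polynomial_functions s V. U = V - zero_set V F)"

lemma istopology_zariski:
  "istopology (\<lambda>U. \<exists>F \<subseteq> polynomial_functions s V. U = V - zero_set V F)"
  unfolding istopology_def
proof (intro conjI allI impI)
  fix S T
  assume "\<exists>F \<subseteq> polynomial_functions s V. S = V - zero_set V F"
    and "\<exists>F \<subseteq> polynomial_functions s V. T = V - zero_set V F"
  then obtain F G where F: "F \<subseteq> polynomial_functions s V" "S = V - zero_set V F"
    and G: "G \<subseteq> polynomial_functions s V" "T = V - zero_set V G"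
    by blast
  let ?H = "{(\<lambda>x. f x * g x) |f g. f \<in> F \<and> g \<in> G}"
  have "?H \<subseteq> polynomial_functions s V"
    using F G by (auto intro: polynomial_functions.mult)
  moreover have "S \<inter> T = V - zero_set V ?H"
    unfolding F G zero_set_def by fastforce
  ultimately show "\<exists>F \<subseteq> polynomial_functions s V. S \<inter> T = V - zero_set V F"
    by blast
next
  fix K
  assume "\<forall>S\<in>K. \<exists>F \<subseteq> polynomial_functions s V. S = V - zero_set V F"
  then obtain F where F: "\<And>S. S \<in> K \<Longrightarrow> F S \<subseteq> polynomial_functions s V"
      "\<And>S. S \<in> K \<Longrightarrow> S = V - zero_set V (F S)"
    by metis
  have "\<Union>K = (\<Union>S\<in>K. V - zero_set V (F S))"
    using F(2) by auto
  also have "\<dots> = V - zero_set V (\<Union>S\<in>K. F S)"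
    unfolding zero_set_def by auto
  finally show "\<exists>F \<subseteq> polynomial_functions s V. \<Union>K = V - zero_set V F"
    using F(1) by (intro exI[of _ "\<Union>S\<in>K. F S"]) auto
qed

lemma openin_zariski:
  "openin (zariski_topology s V) U \<longleftrightarrow>
     (\<exists>F \<subseteq> polynomial_functions s V. U = V - zero_set V F)"
  by (simp add: zariski_topology_def istopology_zariski)

lemma topspace_zariski [simp]: "topspace (zariski_topology s V) = V"
proof -
  have "openin (zariski_topology s V) V"
    unfolding openin_zariski
    by (intro exI[of _ "{\<lambda>_. 1}"]) (auto simp: zero_set_def intro: polynomial_functions.const)
  then show ?thesis
    by (auto simp: topspace_def openin_zariski)
qed

lemma closedin_zariski:
  "closedin (zariski_topology s V) C \<longleftrightarrow>
     (\<exists>F \<subseteq> polynomial_functions s V. C = zero_set V F)"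
proof -
  have sub: "C \<subseteq> V" if "C = zero_set V F" for F :: "('a \<Rightarrow> 'b) set"
    using that by (auto simp: zero_set_def)
  have "V - C = V - zero_set V F \<longleftrightarrow> C = zero_set V F" if "C \<subseteq> V" for F :: "('a \<Rightarrow> 'b) set"
    using that by (auto simp: zero_set_def)
  then show ?thesis
    unfolding closedin_def openin_zariski topspace_zariski using sub by metis
qed


section \<open>Restricted Lie algebras\<close>

locale lie_algebra = vector_space scale
  for scale :: "'k::field \<Rightarrow> 'g::ab_group_add \<Rightarrow> 'g" +
  fixes br :: "'g \<Rightarrow> 'g \<Rightarrow> 'g"
  assumes br_add_left: "br (x + y) z = br x z + br y z"
    and br_add_right: "br x (y + z) = br x y + br x z"
    and br_scale_left: "br (scale c x) y = scale c (br x y)"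
    and br_scale_right: "br x (scale c y) = scale c (br x y)"
    and br_self: "br x x = 0"
    and jacobi: "br x (br y z) + br y (br z x) + br z (br x y) = 0"
begin

text \<open>
  Elements of \<open>'g poly\<close> stand for elements of \<open>\<gg> \<otimes> k[T]\<close>; the following is
  \<open>ad (x \<otimes> T + y \<otimes> 1)\<close>.
\<close>
definition ad_poly :: "'g \<Rightarrow> 'g \<Rightarrow> 'g poly \<Rightarrow> 'g poly" where
  "ad_poly x y q = pCons 0 (map_poly (br x) q) + map_poly (br y) q"

text \<open>
  Jacobson's \<open>s\<^sub>i(x,y)\<close>, determined for \<open>1 \<le> i \<le> p - 1\<close> by
  \<open>ad(x \<otimes> T + y \<otimes> 1)\<^sup>p\<^sup>-\<^sup>1(x \<otimes> 1) = (\<Sum>i. i s\<^sub>i(x,y) \<otimes> T\<^sup>i\<^sup>-\<^sup>1)\<close>.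
\<close>
definition jacobson :: "nat \<Rightarrow> 'g \<Rightarrow> 'g \<Rightarrow> 'g" where
  "jacobson i x y = scale (inverse (of_nat i))
     (coeff ((ad_poly x y ^^ (CHAR('k) - 1)) [:x:]) (i - 1))"

end

locale restricted_lie_algebra = lie_algebra scale br
  for scale :: "'k::field \<Rightarrow> 'g::ab_group_add \<Rightarrow> 'g" and br :: "'g \<Rightarrow> 'g \<Rightarrow> 'g" +
  fixes pmap :: "'g \<Rightarrow> 'g"
  assumes char_pos: "CHAR('k) > 0"
    and ad_pmap: "br (pmap x) = br x ^^ CHAR('k)"
    and pmap_scale: "pmap (scale c x) = scale (c ^ CHAR('k)) (pmap x)"
    and pmap_add: "pmap (x + y) = pmap x + pmap y + (\<Sum>i = 1..<CHAR('k). jacobson i x y)"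
begin

definition p_subalgebra :: "'g set \<Rightarrow> bool" where
  "p_subalgebra S \<longleftrightarrow>
     subspace S \<and> (\<forall>x\<in>S. \<forall>y\<in>S. br x y \<in> S) \<and> (\<forall>x\<in>S. pmap x \<in> S)"

definition semisimple :: "'g \<Rightarrow> bool" where
  "semisimple x \<longleftrightarrow> x \<in> p_subalgebra hull {pmap x}"

definition torus :: "'g set \<Rightarrow> bool" where
  "torus t \<longleftrightarrow> p_subalgebra t \<and> (\<forall>x\<in>t. \<forall>y\<in>t. br x y = 0) \<and> (\<forall>x\<in>t. semisimple x)"

text \<open>The set below is finite if the Lie algebra is finite-dimensional.\<close>
definition max_torus_dim :: nat where
  "max_torus_dim = Max {dim t |t. torus t}"

text \<open>The set \<open>T\<^sub>\<gg>(k)\<close> of embeddings of a torus \<open>t\<close>, and its Zariski topology.\<close>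
definition torus_embeddings :: "'g set \<Rightarrow> ('g \<Rightarrow> 'g) set" where
  "torus_embeddings t = {\<phi> \<in> Hom_on scale scale t.
     inj_on \<phi> t \<and>
     (\<forall>x\<in>t. \<forall>y\<in>t. \<phi> (br x y) = br (\<phi> x) (\<phi> y)) \<and>
     (\<forall>x\<in>t. \<phi> (pmap x) = pmap (\<phi> x))}"

definition torus_embedding_variety :: "'g set \<Rightarrow> ('g \<Rightarrow> 'g) topology" where
  "torus_embedding_variety t =
     subtopology (zariski_topology (fun_scale scale) (Hom_on scale scale t)) (torus_embeddings t)"

text \<open>
  \<open>Lie\<^sub>p(t,k)\<close> for a torus \<open>t\<close>. Compatibility with brackets amounts to \<open>f (br x y) = 0\<close>,
  which holds for every linear form as \<open>t\<close> is abelian.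
\<close>
definition toral_characters :: "'g set \<Rightarrow> ('g \<Rightarrow> 'k) set" where
  "toral_characters t = {f \<in> Hom_on scale (*) t. \<forall>x\<in>t. f (pmap x) = f x ^ CHAR('k)}"

end

locale restricted_lie_module =
  restricted_lie_algebra scale br pmap + M: vector_space scaleM
  for scale :: "'k::field \<Rightarrow> 'g::ab_group_add \<Rightarrow> 'g"
    and br :: "'g \<Rightarrow> 'g \<Rightarrow> 'g" and pmap :: "'g \<Rightarrow> 'g"
    and scaleM :: "'k \<Rightarrow> 'm::ab_group_add \<Rightarrow> 'm" +
  fixes act :: "'g \<Rightarrow> 'm \<Rightarrow> 'm"
  assumes act_add_left: "act (x + y) m = act x m + act y m"
    and act_add_right: "act x (m + n) = act x m + act x n"
    and act_scale_left: "act (scale c x) m = scaleM c (act x m)"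
    and act_scale_right: "act x (scaleM c m) = scaleM c (act x m)"
    and act_br: "act (br x y) m = act x (act y m) - act y (act x m)"
    and act_pmap: "act (pmap x) = act x ^^ CHAR('k)"
begin

definition weight_space :: "'g set \<Rightarrow> ('g \<Rightarrow> 'k) \<Rightarrow> 'm set" where
  "weight_space t f = {m. \<forall>x\<in>t. act x m = scaleM (f x) m}"

definition weights :: "'g set \<Rightarrow> ('g \<Rightarrow> 'k) set" where
  "weights t = {f \<in> Hom_on scale (*) t. weight_space t f \<noteq> {0}}"

end

end

theory Submission
  imports Defs
begin

text \<open>
  The multiplicity of a weight does not change when the torus moves in an irreducible family, and the
  symmetries of the torus itself belong to this family.
  
  For an embedding \<open>\<phi>\<close> of \<open>t\<close> and a toral character \<open>f\<close> let \<open>M\<^sub>f(\<phi>)\<close> be the space of all \<open>m\<close> with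
  \<open>\<phi>(x).m = f(x) m\<close> for \<open>x \<in> t\<close>. The torus is spanned by toral elements, that is, elements fixed by
  the \<open>p\<close>-map (\<open>span_toral\<close>; this is Lang's theorem for the \<open>p\<close>-semilinear injective \<open>p\<close>-map on \<open>t\<close>).
  If \<open>h\<close> is toral, then the action \<open>u\<close> of \<open>\<phi>(h)\<close> satisfies \<open>u\<^sup>p = u\<close>, and \<open>1 - (u - f(h))\<^sup>p\<^sup>-\<^sup>1\<close> is an
  idempotent with image the eigenspace of \<open>u\<close> for the eigenvalue \<open>f(h)\<close>. Multiplying these
  commuting idempotents over a finite spanning set of toral elements gives an idempotent with image
  \<open>M\<^sub>f(\<phi>)\<close>, and its entries are polynomial functions of \<open>\<phi>\<close>.
  
  The rank of a polynomial family of linear maps is lower semicontinuous for the Zariski topology. For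
  idempotents \<open>P\<close>, the rank of \<open>1 - P\<close> is lower semicontinuous as well, and both ranks add up to
  \<open>dim M\<close>. So the rank of \<open>P\<close> is locally constant, hence constant on an irreducible space
  (\<open>rank_idempotent_family_const\<close>): \<open>dim M\<^sub>f(\<phi>)\<close> does not depend on \<open>\<phi>\<close>.
  
  Given non-zero toral characters \<open>f\<close> and \<open>g\<close>, some toral \<open>h\<close> satisfies \<open>f(h) = 1\<close> and \<open>g(h) \<noteq> 0\<close>, because
  the additive group of toral elements is not the union of the two proper subgroups on which \<open>f\<close> and
  \<open>g\<close> vanish. Then \<open>x \<mapsto> x + (g(x) - f(x)) h\<close> is an automorphism \<open>\<tau>\<close> of the restricted Lie algebra \<open>t\<close>
  with \<open>f \<circ> \<tau> = g\<close>. Comparing \<open>\<tau>\<close> with the inclusion gives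
  \<open>dim M\<^sub>f = dim M\<^sub>g(\<tau>) = dim M\<^sub>g\<close> (\<open>dim_weight_space_eq\<close>). Every weight is a toral character, so both assertions
  follow once a non-zero module is known to have a weight at all (\<open>weights_nonempty\<close>).
\<close>

section \<open>Polynomial families of linear maps\<close>

text \<open>
  Families, not sets: vectors depending on a parameter may coincide for special parameters, and such
  a coincidence has to count as a dependence.
\<close>
definition independent_family ::
    "('k::field \<Rightarrow> 'w::ab_group_add \<Rightarrow> 'w) \<Rightarrow> 'i set \<Rightarrow> ('i \<Rightarrow> 'w) \<Rightarrow> bool" where
  "independent_family scale I f \<longleftrightarrow>
     (\<forall>c. (\<Sum>i\<in>I. scale (c i) (f i)) = 0 \<longrightarrow> (\<forall>i\<in>I. c i = 0))"

lemma independent_familyD: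
  "independent_family scale I f \<Longrightarrow> (\<Sum>i\<in>I. scale (c i) (f i)) = 0 \<Longrightarrow> i \<in> I \<Longrightarrow> c i = 0"
  by (auto simp: independent_family_def)

context vector_space
begin

lemma independent_family_id:
  assumes "finite B" "independent B"
  shows "independent_family scale B (\<lambda>b. b)"
  unfolding independent_family_def
  by (intro allI impI ballI independentD[OF assms(2,1) subset_refl])

lemma independent_family_inj_on:
  assumes I: "finite I" and f: "independent_family scale I f"
  shows "inj_on f I"
proof (rule inj_onI, rule ccontr)
  fix i j assume ij: "i \<in> I" "j \<in> I" "f i = f j" "i \<noteq> j"
  let ?c = "\<lambda>l. if l = i then 1 else if l = j then - 1 else 0"
  have "(\<Sum>l\<in>I. scale (?c l) (f l)) = (\<Sum>l\<in>{i, j}. scale (?c l) (f l))"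
    using I ij by (intro sum.mono_neutral_right) auto
  also have "\<dots> = 0"
    using ij by simp
  finally show False
    using independent_familyD[OF f, of ?c i] ij by simp
qed

lemma independent_family_image:
  assumes I: "finite I" and f: "independent_family scale I f"
  shows "independent (f ` I)"
proof (rule independent_if_scalars_zero)
  show "finite (f ` I)"
    using I by simp
next
  fix c y assume c: "(\<Sum>x\<in>f ` I. scale (c x) x) = 0" and y: "y \<in> f ` I"
  have "(\<Sum>i\<in>I. scale (c (f i)) (f i)) = 0"
    using c by (simp add: sum.reindex[OF independent_family_inj_on[OF I f]])
  then show "c y = 0"
    using independent_familyD[OF f, of "\<lambda>i. c (f i)"] y by auto
qed

lemma exists_linear_form_nonzero:
  assumes "v \<noteq> 0"
  obtains l where "Vector_Spaces.linear scale (*) l" "l v \<noteq> 0"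
proof -
  interpret F: vector_space "(*) :: 'a \<Rightarrow> 'a \<Rightarrow> 'a"
    by unfold_locales (auto simp: algebra_simps)
  interpret P: vector_space_pair scale "(*) :: 'a \<Rightarrow> 'a \<Rightarrow> 'a" ..
  have "independent {v}"
    using assms by simp
  then obtain l where "Vector_Spaces.linear scale (*) l" "l v = 1"
    using P.linear_independent_extend[of "{v}" "\<lambda>_. 1"] by auto
  then show ?thesis
    using that by simp
qed

end

lemma polynomial_functions_uminus:
  fixes s :: "'k::field \<Rightarrow> 'v::plus \<Rightarrow> 'v"
  assumes "f \<in> polynomial_functions s V"
  shows "(\<lambda>x. - f x) \<in> polynomial_functions s V"
  using polynomial_functions.mult[OF polynomial_functions.const[of "-1"] assms] by simp

lemma polynomial_functions_diff:
  fixes s :: "'k::field \<Rightarrow> 'v::plus \<Rightarrow> 'v"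
  assumes "f \<in> polynomial_functions s V" "g \<in> polynomial_functions s V"
  shows "(\<lambda>x. f x - g x) \<in> polynomial_functions s V"
  using polynomial_functions.add[OF assms(1) polynomial_functions_uminus[OF assms(2)]] by simp

lemma polynomial_functions_sum:
  fixes s :: "'k::field \<Rightarrow> 'v::plus \<Rightarrow> 'v"
  assumes "\<And>i. i \<in> I \<Longrightarrow> f i \<in> polynomial_functions s V"
  shows "(\<lambda>x. \<Sum>i\<in>I. f i x) \<in> polynomial_functions s V"
  using assms
  by (induction I rule: infinite_finite_induct)
     (auto intro: polynomial_functions.const polynomial_functions.add)

text \<open>
  Testing with all linear forms says that the coordinates are polynomial functions, without choosing a basis.
\<close>
definition polynomial_map ::
    "('k::field \<Rightarrow> 'v::plus \<Rightarrow> 'v) \<Rightarrow> 'v set \<Rightarrow> ('k \<Rightarrow> 'w::ab_group_add \<Rightarrow> 'w) \<Rightarrow> ('v \<Rightarrow> 'w) \<Rightarrow> bool" where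
  "polynomial_map s V scale f \<longleftrightarrow>
     (\<forall>l. Vector_Spaces.linear scale (*) l \<longrightarrow> (\<lambda>x. l (f x)) \<in> polynomial_functions s V)"

lemma polynomial_mapD:
  "polynomial_map s V scale f \<Longrightarrow> Vector_Spaces.linear scale (*) l \<Longrightarrow>
     (\<lambda>x. l (f x)) \<in> polynomial_functions s V"
  by (simp add: polynomial_map_def)

context vector_space
begin

lemma linear_form_simps:
  assumes "Vector_Spaces.linear scale (*) l"
  shows "l (x + y) = l x + l y" "l (x - y) = l x - l y" "l (scale c x) = c * l x" "l 0 = 0"
    "l (sum f I) = (\<Sum>i\<in>I. l (f i))"
proof -
  interpret l: Vector_Spaces.linear scale "(*)" l
    by fact
  show "l (x + y) = l x + l y" "l (x - y) = l x - l y" "l (scale c x) = c * l x" "l 0 = 0"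
    "l (sum f I) = (\<Sum>i\<in>I. l (f i))"
    by (simp_all add: l.add l.diff l.scale l.sum)
qed

lemma polynomial_map_const: "polynomial_map s V scale (\<lambda>_. w)"
  by (simp add: polynomial_map_def polynomial_functions.const)

lemma polynomial_map_add:
  "polynomial_map s V scale f \<Longrightarrow> polynomial_map s V scale g \<Longrightarrow>
     polynomial_map s V scale (\<lambda>x. f x + g x)"
  by (simp add: polynomial_map_def linear_form_simps polynomial_functions.add)

lemma polynomial_map_diff:
  "polynomial_map s V scale f \<Longrightarrow> polynomial_map s V scale g \<Longrightarrow>
     polynomial_map s V scale (\<lambda>x. f x - g x)"
  by (simp add: polynomial_map_def linear_form_simps polynomial_functions_diff)

lemma polynomial_map_scale:
  "c \<in> polynomial_functions s V \<Longrightarrow> polynomial_map s V scale f \<Longrightarrow>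
     polynomial_map s V scale (\<lambda>x. scale (c x) (f x))"
  by (simp add: polynomial_map_def linear_form_simps polynomial_functions.mult)

text \<open>
  Gaussian elimination without divisions: a linear form \<open>l\<close> that does not vanish on \<open>f\<^sub>j(x\<^sub>0)\<close> serves as
  pivot, and \<open>g\<^sub>i = l(f\<^sub>j) f\<^sub>i - l(f\<^sub>i) f\<^sub>j\<close> is again a polynomial family, with one member less. Wherever
  \<open>l(f\<^sub>j) \<noteq> 0\<close>, the \<open>g\<^sub>i\<close> are independent if and only if \<open>f\<^sub>j\<close> and the \<open>f\<^sub>i\<close> are. The function \<open>d\<close> is the product of the pivots.
\<close>
lemma independence_open:
  assumes "finite I"
    and "\<And>i. i \<in> I \<Longrightarrow> polynomial_map s V scale (f i)"
    and "independent_family scale I (\<lambda>i. f i x0)"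
  shows "\<exists>d \<in> polynomial_functions s V. d x0 \<noteq> 0 \<and>
           (\<forall>x. d x \<noteq> 0 \<longrightarrow> independent_family scale I (\<lambda>i. f i x))"
  using assms
proof (induction I arbitrary: f rule: finite_induct)
  case empty
  show ?case
    by (intro bexI[of _ "\<lambda>_. 1"]) (auto simp: independent_family_def intro: polynomial_functions.const)
next
  case (insert j I)
  have sum_insert_j: "(\<Sum>i\<in>insert j I. scale (c i) (f i x)) =
      scale (c j) (f j x) + (\<Sum>i\<in>I. scale (c i) (f i x))" for c x
    using insert.hyps by simp
  have "f j x0 \<noteq> 0"
  proof
    assume "f j x0 = 0"
    then have "(\<Sum>i\<in>insert j I. scale ((if i = j then 1 else 0)) (f i x0)) = 0"
      by (intro sum.neutral) auto
    from independent_familyD[OF insert.prems(2) this, of j] show False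
      by simp
  qed
  then obtain l where l: "Vector_Spaces.linear scale (*) l" and lj: "l (f j x0) \<noteq> 0"
    using exists_linear_form_nonzero by blast
  define g where "g i x = scale (l (f j x)) (f i x) - scale (l (f i x)) (f j x)" for i x
  have sum_g: "(\<Sum>i\<in>I. scale (c i) (g i x)) =
      (\<Sum>i\<in>I. scale (c i * l (f j x)) (f i x)) - scale (\<Sum>i\<in>I. c i * l (f i x)) (f j x)" for c x
    by (simp add: g_def scale_right_diff_distrib sum_subtractf scale_sum_left)
  have "\<exists>d \<in> polynomial_functions s V. d x0 \<noteq> 0 \<and>
           (\<forall>x. d x \<noteq> 0 \<longrightarrow> independent_family scale I (\<lambda>i. g i x))"
  proof (rule insert.IH)
    fix i assume i: "i \<in> I"
    show "polynomial_map s V scale (g i)"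
      unfolding g_def using i insert.prems(1)
      by (intro polynomial_map_diff polynomial_map_scale polynomial_mapD[OF _ l]) auto
  next
    show "independent_family scale I (\<lambda>i. g i x0)"
      unfolding independent_family_def
    proof (intro allI impI ballI)
      fix c i assume c: "(\<Sum>i\<in>I. scale (c i) (g i x0)) = 0" and i: "i \<in> I"
      let ?c = "\<lambda>i. if i = j then - (\<Sum>i\<in>I. c i * l (f i x0)) else c i * l (f j x0)"
      have "(\<Sum>i\<in>I. scale (?c i) (f i x0)) = (\<Sum>i\<in>I. scale (c i * l (f j x0)) (f i x0))"
        using insert.hyps by (intro sum.cong) auto
      then have "(\<Sum>i\<in>insert j I. scale (?c i) (f i x0)) = 0"
        using c unfolding sum_insert_j sum_g by simp
      from independent_familyD[OF insert.prems(2) this, of i] show "c i = 0"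
        using i insert.hyps lj by (auto split: if_splits)
    qed
  qed
  then obtain d where d: "d \<in> polynomial_functions s V" "d x0 \<noteq> 0"
    and indep: "\<And>x. d x \<noteq> 0 \<Longrightarrow> independent_family scale I (\<lambda>i. g i x)"
    by blast
  show ?case
  proof (intro bexI conjI allI impI)
    show "(\<lambda>x. d x * l (f j x)) \<in> polynomial_functions s V"
      using d insert.prems(1) by (intro polynomial_functions.mult polynomial_mapD[OF _ l]) auto
    show "d x0 * l (f j x0) \<noteq> 0"
      using d lj by simp
  next
    fix x assume x: "d x * l (f j x) \<noteq> 0"
    show "independent_family scale (insert j I) (\<lambda>i. f i x)"
      unfolding independent_family_def
    proof (rule allI, rule impI)
      fix c assume c: "(\<Sum>i\<in>insert j I. scale (c i) (f i x)) = 0"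
      have "l (\<Sum>i\<in>insert j I. scale (c i) (f i x)) = 0"
        unfolding c by (rule linear_form_simps(4)[OF l])
      then have *: "c j * l (f j x) + (\<Sum>i\<in>I. c i * l (f i x)) = 0"
        unfolding sum_insert_j by (simp add: linear_form_simps[OF l])
      have "(\<Sum>i\<in>I. scale (c i * l (f j x)) (f i x)) =
          scale (l (f j x)) (\<Sum>i\<in>I. scale (c i) (f i x))"
        by (simp add: scale_sum_right mult.commute)
      also have "(\<Sum>i\<in>I. scale (c i) (f i x)) = - scale (c j) (f j x)"
        using c unfolding sum_insert_j by (metis add_eq_0_iff)
      finally have "(\<Sum>i\<in>I. scale (c i) (g i x)) =
          - scale (c j * l (f j x) + (\<Sum>i\<in>I. c i * l (f i x))) (f j x)"
        unfolding sum_g by (simp add: scale_left_distrib mult.commute)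
      then have "(\<Sum>i\<in>I. scale (c i) (g i x)) = 0"
        by (simp add: *)
      moreover have "d x \<noteq> 0"
        using x by simp
      ultimately have I: "\<forall>i\<in>I. c i = 0"
        using indep unfolding independent_family_def by blast
      then have "c j * l (f j x) = 0"
        using * by simp
      then show "\<forall>i\<in>insert j I. c i = 0"
        using I x by simp
    qed
  qed
qed

end

text \<open>
  In an irreducible space two non-empty open sets meet.
\<close>
lemma irreducible_zariski_nonvanishing:
  assumes irr: "irreducible_space (subtopology (zariski_topology s V) T)"
    and d: "d \<in> polynomial_functions s V" "e \<in> polynomial_functions s V"
    and x: "x \<in> V \<inter> T" "d x \<noteq> 0" and y: "y \<in> V \<inter> T" "e y \<noteq> 0"
  shows "\<exists>z \<in> V \<inter> T. d z \<noteq> 0 \<and> e z \<noteq> 0"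
proof (rule ccontr)
  assume *: "\<not> ?thesis"
  let ?X = "subtopology (zariski_topology s V) T"
  have top: "topspace ?X = V \<inter> T"
    by (simp add: topspace_subtopology)
  have closed: "closedin ?X {z \<in> V \<inter> T. f z = 0}" if "f \<in> polynomial_functions s V" for f
    unfolding closedin_subtopology closedin_zariski
    using that by (intro exI[of _ "zero_set V {f}"]) (auto simp: zero_set_def)
  have "{z \<in> V \<inter> T. d z = 0} \<union> {z \<in> V \<inter> T. e z = 0} = V \<inter> T"
    using * by auto
  then have "{z \<in> V \<inter> T. d z = 0} = V \<inter> T \<or> {z \<in> V \<inter> T. e z = 0} = V \<inter> T"
    using irr closed[OF d(1)] closed[OF d(2)] unfolding irreducible_space_def top by blast
  then show False
    using x y by blast
qed

context finite_dimensional_vector_space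
begin

lemma independent_family_card_le_dim:
  assumes "finite I" "independent_family scale I f" "f ` I \<subseteq> S"
  shows "card I \<le> dim S"
  using independent_card_le_dim[OF assms(3) independent_family_image[OF assms(1,2)]]
  by (simp add: card_image[OF independent_family_inj_on[OF assms(1,2)]])

text \<open>
  Preimages under \<open>Q x0\<close> of a basis of its range have independent images near \<open>x0\<close>, too.
\<close>
lemma rank_lower_semicontinuous:
  assumes "\<And>w. polynomial_map s V scale (\<lambda>x. Q x w)"
  shows "\<exists>d \<in> polynomial_functions s V. d x0 \<noteq> 0 \<and>
           (\<forall>x. d x \<noteq> 0 \<longrightarrow> dim (range (Q x0)) \<le> dim (range (Q x)))"
proof -
  obtain B where B: "B \<subseteq> range (Q x0)" "independent B" "range (Q x0) \<subseteq> span B"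
      "card B = dim (range (Q x0))"
    by (rule basis_exists)
  define w where "w = inv (Q x0)"
  have w: "Q x0 (w b) = b" if "b \<in> B" for b
    using that B(1) by (auto simp: w_def intro: f_inv_into_f)
  have "independent_family scale B (\<lambda>b. Q x0 (w b))"
    using independent_family_id[OF finiteI_independent[OF B(2)] B(2)] by (simp add: independent_family_def w cong: sum.cong)
  then obtain d where d: "d \<in> polynomial_functions s V" "d x0 \<noteq> 0"
      "\<And>x. d x \<noteq> 0 \<Longrightarrow> independent_family scale B (\<lambda>b. Q x (w b))"
    using independence_open[of B s V "\<lambda>b x. Q x (w b)" x0] assms finiteI_independent[OF B(2)]
    by blast
  have "dim (range (Q x0)) \<le> dim (range (Q x))" if "d x \<noteq> 0" for x
    using independent_family_card_le_dim[OF finiteI_independent[OF B(2)] d(3)[OF that],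
        of "range (Q x)"] B(4) by auto
  with d show ?thesis
    by blast
qed

lemma dim_range_idempotent:
  assumes P: "Vector_Spaces.linear scale scale P" and idem: "\<And>w. P (P w) = P w"
  shows "dim (range P) + dim (range (\<lambda>w. w - P w)) = dim UNIV"
proof -
  interpret P: Vector_Spaces.linear scale scale P
    by fact
  have lin: "Vector_Spaces.linear scale scale (\<lambda>w. w - P w)"
    by unfold_locales (auto simp: algebra_simps P.add P.scale)
  interpret Q: Vector_Spaces.linear scale scale "\<lambda>w. w - P w"
    by fact
  have sub: "subspace (range P)" "subspace (range (\<lambda>w. w - P w))"
    by (auto intro: P.subspace_image Q.subspace_image subspace_UNIV)
  have "range P \<inter> range (\<lambda>w. w - P w) = {0}"
  proof -
    have zero: "x = 0" if "x = P y" "x = w - P w" for x y w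
    proof -
      have "P x = x"
        by (simp add: that(1) idem)
      moreover have "P x = 0"
        unfolding that(2) by (simp add: P.diff idem)
      ultimately show ?thesis
        by simp
    qed
    show ?thesis
      using zero subspace_0[OF sub(1)] subspace_0[OF sub(2)] by blast
  qed
  moreover have "{x + y |x y. x \<in> range P \<and> y \<in> range (\<lambda>w. w - P w)} = UNIV"
  proof -
    have "w = P w + (w - P w)" for w
      by simp
    then show ?thesis
      by blast
  qed
  ultimately show ?thesis
    using dim_sums_Int[OF sub] by simp
qed

text \<open>
  Neither rank of a complementary pair \<open>P\<close>, \<open>1 - P\<close> can drop under a small change of the
  parameter, and their sum is fixed, so neither can jump. Two points of an irreducible space have
  neighbourhoods that meet.
\<close>
lemma rank_idempotent_family_const:
  assumes irr: "irreducible_space (subtopology (zariski_topology s V) T)"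
    and pol: "\<And>w. polynomial_map s V scale (\<lambda>x. P x w)"
    and lin: "\<And>x. x \<in> V \<inter> T \<Longrightarrow> Vector_Spaces.linear scale scale (P x)"
    and idem: "\<And>x w. x \<in> V \<inter> T \<Longrightarrow> P x (P x w) = P x w"
    and xy: "x \<in> V \<inter> T" "y \<in> V \<inter> T"
  shows "dim (range (P x)) = dim (range (P y))"
proof -
  let ?Q = "\<lambda>x w. w - P x w"
  have polQ: "\<And>w. polynomial_map s V scale (\<lambda>x. ?Q x w)"
    by (intro polynomial_map_diff polynomial_map_const pol)
  have nbhd: "\<exists>d \<in> polynomial_functions s V. d x \<noteq> 0 \<and>
      (\<forall>z \<in> V \<inter> T. d z \<noteq> 0 \<longrightarrow> dim (range (P z)) = dim (range (P x)))" if x: "x \<in> V \<inter> T" for x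
  proof -
    obtain d where d: "d \<in> polynomial_functions s V" "d x \<noteq> 0"
        "\<And>z. d z \<noteq> 0 \<Longrightarrow> dim (range (P x)) \<le> dim (range (P z))"
      using rank_lower_semicontinuous[where Q = P and ?x0.0 = x, OF pol] by blast
    obtain e where e: "e \<in> polynomial_functions s V" "e x \<noteq> 0"
        "\<And>z. e z \<noteq> 0 \<Longrightarrow> dim (range (?Q x)) \<le> dim (range (?Q z))"
      using rank_lower_semicontinuous[where Q = ?Q and ?x0.0 = x, OF polQ] by blast
    have "dim (range (P z)) = dim (range (P x))" if z: "z \<in> V \<inter> T" "d z * e z \<noteq> 0" for z
      using d(3)[of z] e(3)[of z] z dim_range_idempotent[OF lin[OF x] idem[OF x]]
        dim_range_idempotent[OF lin[OF z(1)] idem[OF z(1)]] by simp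
    then show ?thesis
      using d e by (intro bexI[of _ "\<lambda>z. d z * e z"]) (auto intro: polynomial_functions.mult)
  qed
  obtain d where d: "d \<in> polynomial_functions s V" "d x \<noteq> 0"
      "\<And>z. z \<in> V \<inter> T \<Longrightarrow> d z \<noteq> 0 \<Longrightarrow> dim (range (P z)) = dim (range (P x))"
    using nbhd[OF xy(1)] by blast
  obtain e where e: "e \<in> polynomial_functions s V" "e y \<noteq> 0"
      "\<And>z. z \<in> V \<inter> T \<Longrightarrow> e z \<noteq> 0 \<Longrightarrow> dim (range (P z)) = dim (range (P y))"
    using nbhd[OF xy(2)] by blast
  obtain z where "z \<in> V \<inter> T" "d z \<noteq> 0" "e z \<noteq> 0"
    using irreducible_zariski_nonvanishing[OF irr d(1) e(1) xy(1) d(2) xy(2) e(2)] by blast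
  then show ?thesis
    using d(3) e(3) by metis
qed

end

section \<open>Fixed vectors of Frobenius-semilinear maps\<close>

text \<open>
  Let \<open>F\<close> be \<open>p\<close>-semilinear with \<open>F\<^sup>n\<^sup>+\<^sup>1 v = a\<^sub>0 v + \<dots> + a\<^sub>n F\<^sup>n v\<close>. A vector \<open>c\<^sub>0 v + \<dots> + c\<^sub>n F\<^sup>n v\<close> is fixed by \<open>F\<close>
  as soon as \<open>c\<^sub>0 = a\<^sub>0 x\<^sup>p\<close> and \<open>c\<^sub>i\<^sub>+\<^sub>1 = c\<^sub>i\<^sup>p + a\<^sub>i\<^sub>+\<^sub>1 x\<^sup>p\<close> with \<open>x = c\<^sub>n\<close>. The polynomial below is \<open>c\<^sub>i\<close> as
  a function of \<open>x\<close>, and the remaining condition is \<open>c\<^sub>n(x) = x\<close>.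
\<close>
fun lang_poly :: "(nat \<Rightarrow> 'k::comm_ring_1) \<Rightarrow> nat \<Rightarrow> 'k poly" where
  "lang_poly a 0 = monom (a 0) CHAR('k)"
| "lang_poly a (Suc i) = lang_poly a i ^ CHAR('k) + monom (a (Suc i)) CHAR('k)"

lemma lang_poly_dvd:
  fixes a :: "nat \<Rightarrow> 'k::field"
  assumes p: "CHAR('k) > 1"
  shows "monom 1 2 dvd lang_poly a i"
proof (induction i)
  case 0
  show ?case
    using p by (auto simp: monom_1_dvd_iff')
next
  case (Suc i)
  have "lang_poly a i dvd lang_poly a i ^ CHAR('k)"
    using p by (intro dvd_power) auto
  moreover have "monom 1 2 dvd monom (a (Suc i)) CHAR('k)"
    using p by (auto simp: monom_1_dvd_iff')
  ultimately show ?case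
    using Suc by (auto intro: dvd_add dvd_trans)
qed

text \<open>
  The bound on the degree keeps the induction going: the \<open>p\<close>-th power of a polynomial of degree at
  least \<open>p\<close> has degree greater than \<open>p\<close>, so the summand of degree at most \<open>p\<close> cannot cancel it.
\<close>
lemma degree_lang_poly:
  fixes a :: "nat \<Rightarrow> 'k::field"
  assumes p: "CHAR('k) > 1" and "j \<le> i" "a j \<noteq> 0"
  shows "lang_poly a i \<noteq> 0 \<and> degree (lang_poly a i) \<ge> CHAR('k)"
  using assms(2,3)
proof (induction i arbitrary: j)
  case 0
  then show ?case
    by (simp add: degree_monom_eq)
next
  case (Suc i)
  show ?case
  proof (cases "\<exists>j\<le>i. a j \<noteq> 0")
    case True
    then have IH: "lang_poly a i \<noteq> 0" "degree (lang_poly a i) \<ge> CHAR('k)"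
      using Suc.IH by blast+
    have "CHAR('k) * 1 < CHAR('k) * degree (lang_poly a i)"
      using IH p by (intro mult_strict_left_mono) auto
    then have deg: "CHAR('k) < degree (lang_poly a i ^ CHAR('k))"
      using IH by (simp add: degree_power_eq)
    have "degree (monom (a (Suc i)) CHAR('k)) \<le> CHAR('k)"
      by (rule degree_monom_le)
    then have "degree (lang_poly a (Suc i)) = degree (lang_poly a i ^ CHAR('k))"
      using deg by (simp add: degree_add_eq_left)
    then show ?thesis
      using deg by (metis degree_0 less_imp_le not_less_zero)
  next
    case False
    then have "lang_poly a i = 0"
    proof (induction i)
      case (Suc i)
      then have "lang_poly a i = 0" "a (Suc i) = 0"
        by auto
      then show ?case
        using p by simp
    qed simp
    moreover have "j = Suc i"
      using Suc.prems False le_SucE by blast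
    ultimately show ?thesis
      using Suc.prems p by (simp add: degree_monom_eq power_0_left)
  qed
qed

text \<open>
  The polynomial has the form \<open>X\<^sup>2 D\<close> with \<open>D \<noteq> 0\<close>. Non-zero fixed points are therefore the roots of
  \<open>X D - 1\<close>, which is not constant and does not vanish at \<open>0\<close>.
\<close>
lemma lang_poly_fixed_point:
  fixes a :: "nat \<Rightarrow> 'k::alg_closed_field"
  assumes p: "CHAR('k) > 1" and a: "\<exists>j\<le>n. a j \<noteq> 0"
  shows "\<exists>x. x \<noteq> 0 \<and> poly (lang_poly a n) x = x"
proof -
  obtain D where D: "lang_poly a n = monom 1 2 * D"
    by (rule dvdE[OF lang_poly_dvd[OF p]])
  have "D \<noteq> 0"
    using degree_lang_poly[OF p] a D by auto
  then have "degree (monom 1 1 * D) > 0"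
    by (simp add: degree_mult_eq degree_monom_eq)
  moreover have "degree (monom 1 1 * D - 1) = degree (monom 1 1 * D)"
    using calculation degree_add_eq_left[of "- 1" "monom 1 1 * D"] by simp
  ultimately obtain x where x: "poly (monom 1 1 * D - 1) x = 0"
    using alg_closed_imp_poly_has_root by metis
  then have "x \<noteq> 0"
    by (auto simp: poly_monom)
  moreover have "poly (lang_poly a n) x = x"
    using x by (simp add: D poly_monom power2_eq_square algebra_simps)
  ultimately show ?thesis
    by blast
qed

locale frobenius_semilinear = finite_dimensional_vector_space scale Basis
  for scale :: "'k::alg_closed_field \<Rightarrow> 'v::ab_group_add \<Rightarrow> 'v" and Basis :: "'v set" +
  fixes U :: "'v set" and F :: "'v \<Rightarrow> 'v"
  assumes subspace_U: "subspace U"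
    and F_closed: "x \<in> U \<Longrightarrow> F x \<in> U"
    and F_add: "x \<in> U \<Longrightarrow> y \<in> U \<Longrightarrow> F (x + y) = F x + F y"
    and F_scale: "x \<in> U \<Longrightarrow> F (scale c x) = scale (c ^ CHAR('k)) (F x)"
    and F_kernel: "x \<in> U \<Longrightarrow> F x = 0 \<Longrightarrow> x = 0"
    and char_gt_1: "CHAR('k) > 1"
begin

definition fixed :: "'v set" where
  "fixed = {h \<in> U. F h = h}"

lemma span_fixed_subset: "span fixed \<subseteq> U"
  using span_minimal[OF _ subspace_U] by (auto simp: fixed_def)

lemma F_zero: "F 0 = 0"
  using F_scale[OF subspace_0[OF subspace_U], of 0] char_gt_1 by (simp add: power_0_left)

lemma F_diff: "x \<in> U \<Longrightarrow> y \<in> U \<Longrightarrow> F (x - y) = F x - F y"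
  using F_add[of "x - y" y] subspace_diff[OF subspace_U, of x y] by (simp add: algebra_simps)

lemma F_sum: "(\<And>i. i \<in> I \<Longrightarrow> f i \<in> U) \<Longrightarrow> F (\<Sum>i\<in>I. f i) = (\<Sum>i\<in>I. F (f i))"
  by (induction I rule: infinite_finite_induct)
     (auto simp: F_zero F_add subspace_sum[OF subspace_U])

lemma F_surj_on_span:
  assumes "w \<in> span fixed"
  shows "\<exists>z \<in> span fixed. F z = w"
  using assms
proof (induction rule: span_induct_alt)
  case base
  show ?case
    using F_zero span_zero by blast
next
  case (step c h w)
  then obtain z where z: "z \<in> span fixed" "F z = w"
    by blast
  obtain d where d: "d ^ CHAR('k) = c"
    using nth_root_exists[of "CHAR('k)" c] char_gt_1 by auto
  have h: "h \<in> U" "F h = h"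
    using step by (auto simp: fixed_def)
  have "F (scale d h + z) = scale c h + w"
    using h z d span_fixed_subset subspace_scale[OF subspace_U h(1)] by (auto simp: F_add F_scale)
  then show ?case
    using span_add[OF span_scale[OF span_base[OF step(1)], of d] z(1)] by blast
qed

lemma artin_schreier_root:
  "\<exists>d::'k. d ^ CHAR('k) - d = c"
proof -
  let ?q = "monom 1 CHAR('k) + [:- c, - 1:]"
  have "degree ?q = degree (monom (1::'k) CHAR('k))"
    using char_gt_1 degree_add_eq_left[of "[:- c, - 1:]" "monom (1::'k) CHAR('k)"]
    by (simp add: degree_monom_eq)
  then have "degree ?q > 0"
    using char_gt_1 by (simp add: degree_monom_eq)
  then obtain d where "poly ?q d = 0"
    using alg_closed_imp_poly_has_root by blast
  then show ?thesis
    by (intro exI[of _ d]) (simp add: poly_monom algebra_simps)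
qed

lemma F_minus_id_surj_on_span:
  assumes "w \<in> span fixed"
  shows "\<exists>z \<in> span fixed. F z - z = w"
  using assms
proof (induction rule: span_induct_alt)
  case base
  show ?case
    using F_zero span_zero by force
next
  case (step c h w)
  then obtain z where z: "z \<in> span fixed" "F z - z = w"
    by blast
  obtain d where d: "d ^ CHAR('k) - d = c"
    using artin_schreier_root by blast
  have h: "h \<in> U" "F h = h"
    using step by (auto simp: fixed_def)
  have "F (scale d h + z) - (scale d h + z) = scale (d ^ CHAR('k) - d) h + (F z - z)"
    using h z span_fixed_subset subspace_scale[OF subspace_U h(1)]
    by (auto simp: F_add F_scale scale_left_diff_distrib)
  then show ?case
    unfolding d z(2) using span_add[OF span_scale[OF span_base[OF step(1)], of d] z(1)] by blast
qed

text \<open>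
  On the span \<open>W\<close> of the fixed vectors \<open>F\<close> is onto, so that injectivity on \<open>U\<close> amounts to injectivity
  modulo \<open>W\<close>.
\<close>
lemma F_reflects_span:
  assumes "x \<in> U" "F x \<in> span fixed"
  shows "x \<in> span fixed"
proof -
  obtain z where z: "z \<in> span fixed" "F z = F x"
    using F_surj_on_span assms(2) by blast
  have zU: "z \<in> U"
    using z(1) span_fixed_subset by blast
  have "F (x - z) = 0"
    by (simp add: F_diff assms(1) zU z(2))
  then have "x - z = 0"
    using F_kernel[OF subspace_diff[OF subspace_U assms(1) zU]] by blast
  then show ?thesis
    using z(1) by simp
qed

lemma span_Un_lessThan:
  fixes f :: "nat \<Rightarrow> 'v"
  assumes "x \<in> span (S \<union> f ` {..<n})"
  shows "\<exists>a. \<exists>w \<in> span S. x = w + (\<Sum>i<n. scale (a i) (f i))"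
  using assms
proof (induction n arbitrary: x)
  case (Suc n)
  have "S \<union> f ` {..<Suc n} = insert (f n) (S \<union> f ` {..<n})"
    by (auto simp: lessThan_Suc)
  then obtain c where "x - scale c (f n) \<in> span (S \<union> f ` {..<n})"
    using Suc.prems span_breakdown_eq by metis
  from Suc.IH[OF this] obtain a w where w: "w \<in> span S"
    "x - scale c (f n) = w + (\<Sum>i<n. scale (a i) (f i))"
    by blast
  have "(\<Sum>i<n. scale ((a(n := c)) i) (f i)) = (\<Sum>i<n. scale (a i) (f i))"
    by (intro sum.cong) auto
  then have "x = w + (\<Sum>i<Suc n. scale ((a(n := c)) i) (f i))"
    using w(2) by (simp add: algebra_simps)
  then show ?case
    using w(1) by blast
qed auto

lemma exists_dependent_iterate:
  fixes f :: "nat \<Rightarrow> 'v"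
  shows "\<exists>n. f n \<in> span (S \<union> f ` {..<n})"
proof (rule ccontr)
  assume *: "\<nexists>n. f n \<in> span (S \<union> f ` {..<n})"
  have "n \<le> dim (S \<union> f ` {..<n})" for n
  proof (induction n)
    case (Suc n)
    have "S \<union> f ` {..<Suc n} = insert (f n) (S \<union> f ` {..<n})"
      by (auto simp: lessThan_Suc)
    then show ?case
      using * Suc by (simp add: dim_insert)
  qed simp
  from this[of "Suc dimension"] show False
    using dim_subset_UNIV[of "S \<union> f ` {..<Suc dimension}"] by linarith
qed

text \<open>
  Lang's theorem for the general linear group, in the form: an injective \<open>p\<close>-semilinear map has a
  basis of fixed vectors. Let \<open>W\<close> be the span of the fixed vectors and \<open>v \<notin> W\<close>. The first relation modulo \<open>W\<close>
  between \<open>v, F v, F\<^sup>2 v, \<dots>\<close> yields some \<open>w \<notin> W\<close> with \<open>F w - w \<in> W\<close>. Since \<open>F - 1\<close> maps \<open>W\<close> onto \<open>W\<close>, a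
  correction of \<open>w\<close> by an element of \<open>W\<close> is fixed, although it lies outside \<open>W\<close>.
\<close>
lemma span_fixed: "span fixed = U"
proof (rule ccontr)
  assume "span fixed \<noteq> U"
  then obtain v where v: "v \<in> U" "v \<notin> span fixed"
    using span_fixed_subset by blast
  define f where "f i = (F ^^ i) v" for i
  have fU: "f i \<in> U" for i
    by (induction i) (auto simp: f_def v F_closed)
  have f_Suc: "F (f i) = f (Suc i)" for i
    by (simp add: f_def)
  have f_notin: "f i \<notin> span fixed" for i
  proof (induction i)
    case 0
    show ?case
      using v by (simp add: f_def)
  next
    case (Suc i)
    then show ?case
      using F_reflects_span[OF fU[of i]] by (auto simp: f_Suc)
  qed
  define m where "m = (LEAST n. f n \<in> span (fixed \<union> f ` {..<n}))"
  have m: "f m \<in> span (fixed \<union> f ` {..<m})"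
    unfolding m_def by (rule LeastI_ex[OF exists_dependent_iterate])
  have m_min: "f n \<notin> span (fixed \<union> f ` {..<n})" if "n < m" for n
    using not_less_Least that unfolding m_def by blast
  have "m \<noteq> 0"
    using m f_notin[of 0] by (cases m) auto
  then obtain n where n: "m = Suc n"
    using not0_implies_Suc by blast
  obtain a w0 where w0: "w0 \<in> span fixed" "f (Suc n) = w0 + (\<Sum>i<Suc n. scale (a i) (f i))"
    using span_Un_lessThan[OF m] unfolding n by blast
  \<comment> \<open>The iterates stay outside \<open>W\<close>, so the relation involves some of them.\<close>
  have "\<exists>j\<le>n. a j \<noteq> 0"
  proof (rule ccontr)
    assume "\<not> ?thesis"
    then have "f (Suc n) = w0"
      unfolding w0(2) by simp
    then show False
      using w0(1) f_notin by metis
  qed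
  then obtain x where x: "x \<noteq> 0" "poly (lang_poly a n) x = x"
    using lang_poly_fixed_point char_gt_1 by blast
  define c where "c i = poly (lang_poly a i) x" for i
  have c_0: "c 0 = a 0 * x ^ CHAR('k)"
    by (simp add: c_def poly_monom)
  have c_Suc: "c (Suc i) = c i ^ CHAR('k) + a (Suc i) * x ^ CHAR('k)" for i
    by (simp add: c_def poly_monom)
  have c_n: "c n = x"
    using x by (simp add: c_def)
  define w where "w = (\<Sum>i<Suc n. scale (c i) (f i))"
  have wU: "w \<in> U"
    unfolding w_def by (intro subspace_sum subspace_scale subspace_U fU)
  have "F w = (\<Sum>i<Suc n. scale (c i ^ CHAR('k)) (f (Suc i)))"
    unfolding w_def by (subst F_sum) (auto simp: F_scale fU f_Suc subspace_scale[OF subspace_U])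
  also have "\<dots> = (\<Sum>i<n. scale (c i ^ CHAR('k)) (f (Suc i))) +
      (scale (x ^ CHAR('k)) w0 + (\<Sum>i<Suc n. scale (a i * x ^ CHAR('k)) (f i)))"
    by (simp add: c_n w0(2) scale_right_distrib scale_sum_right mult.commute del: sum.lessThan_Suc
          add: sum.lessThan_Suc[where n = n and g = "\<lambda>i. scale (c i ^ CHAR('k)) (f (Suc i))"])
  also have "(\<Sum>i<Suc n. scale (a i * x ^ CHAR('k)) (f i)) =
      scale (a 0 * x ^ CHAR('k)) (f 0) + (\<Sum>i<n. scale (a (Suc i) * x ^ CHAR('k)) (f (Suc i)))"
    by (subst sum.lessThan_Suc_shift) simp
  also have "(\<Sum>i<n. scale (c i ^ CHAR('k)) (f (Suc i))) + (scale (x ^ CHAR('k)) w0 +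
      (scale (a 0 * x ^ CHAR('k)) (f 0) + (\<Sum>i<n. scale (a (Suc i) * x ^ CHAR('k)) (f (Suc i))))) =
      scale (x ^ CHAR('k)) w0 + (scale (c 0) (f 0) + (\<Sum>i<n. scale (c (Suc i)) (f (Suc i))))"
    by (simp add: c_0 c_Suc scale_left_distrib sum.distrib algebra_simps)
  also have "scale (c 0) (f 0) + (\<Sum>i<n. scale (c (Suc i)) (f (Suc i))) = w"
    unfolding w_def by (subst sum.lessThan_Suc_shift) simp
  finally have Fw: "F w = scale (x ^ CHAR('k)) w0 + w" .
  have "- scale (x ^ CHAR('k)) w0 \<in> span fixed"
    by (intro span_neg span_scale w0)
  then obtain z where z: "z \<in> span fixed" "F z - z = - scale (x ^ CHAR('k)) w0"
    using F_minus_id_surj_on_span by blast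
  have zU: "z \<in> U"
    using z span_fixed_subset by blast
  have "F (w + z) = w + z"
    using Fw z(2) by (simp add: F_add[OF wU zU] algebra_simps)
  then have "w + z \<in> span fixed"
    using wU zU subspace_add[OF subspace_U] by (intro span_base) (simp add: fixed_def)
  then have w: "w \<in> span fixed"
    using z(1) span_diff[of "w + z" fixed z] by simp
  \<comment> \<open>Since \<open>x \<noteq> 0\<close>, the membership \<open>w \<in> W\<close> is a shorter relation between the iterates.\<close>
  have "scale x (f n) = w - (\<Sum>i<n. scale (c i) (f i))"
    by (simp add: w_def c_n)
  also have "\<dots> \<in> span (fixed \<union> f ` {..<n})"
    using w by (intro span_diff span_sum span_scale)
      (auto intro: span_base subsetD[OF span_mono[of fixed "fixed \<union> f ` {..<n}"]])
  finally have "scale (inverse x) (scale x (f n)) \<in> span (fixed \<union> f ` {..<n})"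
    by (rule span_scale)
  then have "f n \<in> span (fixed \<union> f ` {..<n})"
    using x by simp
  then show False
    using m_min n by blast
qed

end

section \<open>Operators annihilated by \<open>X\<^sup>p - X\<close>\<close>

text \<open>
  The Horner scheme for \<open>q(u) m\<close>.
\<close>
definition poly_act :: "('k::field \<Rightarrow> 'm::ab_group_add \<Rightarrow> 'm) \<Rightarrow> ('m \<Rightarrow> 'm) \<Rightarrow> 'k poly \<Rightarrow> 'm \<Rightarrow> 'm" where
  "poly_act scale u q m = fold_coeffs (\<lambda>c v. scale c m + u v) q 0"

locale endomorphism = vector_space scale
  for scale :: "'k::field \<Rightarrow> 'm::ab_group_add \<Rightarrow> 'm" +
  fixes u :: "'m \<Rightarrow> 'm"
  assumes u_add: "u (m + n) = u m + u n"
    and u_scale: "u (scale c m) = scale c (u m)"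
begin

lemma u_zero [simp]: "u 0 = 0"
  using u_scale[of 0 0] by simp

lemma poly_act_0 [simp]: "poly_act scale u 0 m = 0"
  by (simp add: poly_act_def)

lemma poly_act_pCons [simp]:
  "poly_act scale u (pCons c q) m = scale c m + u (poly_act scale u q m)"
  by (cases "c = 0"; cases "q = 0") (auto simp: poly_act_def)

lemma poly_act_add: "poly_act scale u (q + r) m = poly_act scale u q m + poly_act scale u r m"
  by (induction q r rule: poly_induct2) (simp_all add: u_add scale_left_distrib algebra_simps)

lemma poly_act_smult: "poly_act scale u (smult c q) m = scale c (poly_act scale u q m)"
  by (induction q) (simp_all add: u_scale scale_right_distrib)

lemma poly_act_diff: "poly_act scale u (q - r) m = poly_act scale u q m - poly_act scale u r m"
  using poly_act_add[of "q - r" r m] by (simp add: algebra_simps)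

lemma poly_act_add_right: "poly_act scale u q (m + n) = poly_act scale u q m + poly_act scale u q n"
  by (induction q) (simp_all add: u_add scale_right_distrib algebra_simps)

lemma poly_act_scale_right: "poly_act scale u q (scale c m) = scale c (poly_act scale u q m)"
  by (induction q) (simp_all add: u_scale scale_right_distrib mult.commute)

lemma poly_act_mult: "poly_act scale u (q * r) m = poly_act scale u q (poly_act scale u r m)"
  by (induction q) (simp_all add: poly_act_add poly_act_smult)

lemma poly_act_1 [simp]: "poly_act scale u 1 m = m"
  using poly_act_pCons[of 1 0 m] by (simp add: one_pCons del: poly_act_pCons)

lemma poly_act_monom: "poly_act scale u (monom 1 n) m = (u ^^ n) m"
  by (induction n) (simp_all add: monom_Suc)

lemma poly_act_commute:
  assumes "\<And>m n. v (m + n) = v m + v n" "\<And>c m. v (scale c m) = scale c (v m)"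
    and "\<And>m. v (u m) = u (v m)"
  shows "v (poly_act scale u q m) = poly_act scale u q (v m)"
proof (induction q)
  case 0
  show ?case
    using assms(2)[of 0 0] by simp
next
  case (pCons c q)
  then show ?case
    by (simp add: assms)
qed

lemma poly_act_eigenvector:
  "u m = scale a m \<Longrightarrow> poly_act scale u q m = scale (poly q a) m"
  by (induction q) (simp_all add: u_scale scale_left_distrib mult.commute)

lemma funpow_eigenvector: "u m = scale a m \<Longrightarrow> (u ^^ n) m = scale (a ^ n) m"
  by (induction n) (simp_all add: u_scale mult.commute)

end

text \<open>
  The eigenvector has the form \<open>r(u) m\<close>, so that it inherits from \<open>m\<close> the property of being an eigenvector of
  the operators that commute with \<open>u\<close>. Linear factors of \<open>q\<close> are split off until the next one kills the vector.
\<close>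
lemma exists_eigenvector_poly_act:
  fixes scale :: "'k::alg_closed_field \<Rightarrow> 'm::ab_group_add \<Rightarrow> 'm"
  assumes "endomorphism scale u"
    and "q \<noteq> 0" "poly_act scale u q m = 0" "m \<noteq> 0"
  shows "\<exists>r a. poly_act scale u r m \<noteq> 0 \<and>
           u (poly_act scale u r m) = scale a (poly_act scale u r m)"
  using assms(2,3)
proof (induction "degree q" arbitrary: q rule: less_induct)
  case less
  interpret endomorphism scale u
    by fact
  have "degree q > 0"
  proof (rule ccontr)
    assume "\<not> ?thesis"
    then obtain c where "q = [:c:]"
      using degree_eq_zeroE by blast
    then show False
      using less.prems assms(4) by simp
  qed
  then obtain a where "poly q a = 0"
    using alg_closed_imp_poly_has_root by blast
  then obtain r where r: "q = [:- a, 1:] * r"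
    using poly_eq_0_iff_dvd by (metis dvdE)
  show ?case
  proof (cases "poly_act scale u r m = 0")
    case True
    have "r \<noteq> 0"
      using r less.prems by auto
    moreover have "degree r < degree q"
      using r calculation by (simp add: degree_mult_eq del: mult_pCons_left)
    ultimately show ?thesis
      using less.hyps True by blast
  next
    case False
    have "u (poly_act scale u r m) = scale a (poly_act scale u r m)"
      using less.prems(2) unfolding r poly_act_mult by simp
    then show ?thesis
      using False by blast
  qed
qed

text \<open>
  On the prime field, \<open>b \<mapsto> 1 - (b - a)\<^sup>p\<^sup>-\<^sup>1\<close> is the indicator function of \<open>a\<close>. The corresponding polynomial in an
  operator \<open>u\<close> with \<open>u\<^sup>p = u\<close> projects onto the eigenspace for \<open>a\<close>.
\<close>
definition eigenprojector :: "'k::field \<Rightarrow> 'k poly" where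
  "eigenprojector a = 1 - [:- a, 1:] ^ (CHAR('k) - 1)"

text \<open>
  Since \<open>(X - a)\<^sup>p = X\<^sup>p - a\<close>, the product is \<open>(X - a) - (X\<^sup>p - a)\<close>.
\<close>
lemma linear_times_eigenprojector:
  fixes a :: "'k::field"
  assumes p: "prime CHAR('k)" and a: "a ^ CHAR('k) = a"
  shows "[:- a, 1:] * eigenprojector a = monom 1 1 - monom 1 CHAR('k)"
proof -
  have p': "prime CHAR('k poly)"
    using p by simp
  have X: "[:- a, 1:] + [:a:] = monom 1 1"
    by (simp add: monom_Suc)
  have "([:- a, 1:] + [:a:]) ^ CHAR('k) = [:- a, 1:] ^ CHAR('k) + [:a:] ^ CHAR('k)"
    using freshmans_dream[OF p' refl, of "[:- a, 1:]" "[:a:]"] by simp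
  then have *: "[:- a, 1:] ^ CHAR('k) = monom 1 CHAR('k) - [:a:]"
    unfolding X monom_power by (simp add: poly_const_pow a algebra_simps)
  have "CHAR('k) = Suc (CHAR('k) - 1)"
    using prime_gt_0_nat[OF p] by simp
  then have "[:- a, 1:] * [:- a, 1:] ^ (CHAR('k) - 1) = [:- a, 1:] ^ CHAR('k)"
    by (metis power_Suc)
  then have "[:- a, 1:] * eigenprojector a = [:- a, 1:] - (monom 1 CHAR('k) - [:a:])"
    unfolding eigenprojector_def right_diff_distrib * by simp
  also have "\<dots> = monom 1 1 - monom 1 CHAR('k)"
    unfolding X[symmetric] by (simp add: algebra_simps)
  finally show ?thesis .
qed

context endomorphism
begin

lemma eigenprojector_eigenvector:
  assumes p: "prime CHAR('k)" and u: "u ^^ CHAR('k) = u" and a: "a ^ CHAR('k) = a"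
  shows "u (poly_act scale u (eigenprojector a) m) = scale a (poly_act scale u (eigenprojector a) m)"
proof -
  have "poly_act scale u ([:- a, 1:] * eigenprojector a) m = 0"
    unfolding linear_times_eigenprojector[OF p a] poly_act_diff poly_act_monom u by simp
  then show ?thesis
    unfolding poly_act_mult by simp
qed

lemma eigenprojector_id:
  assumes p: "prime CHAR('k)" and m: "u m = scale a m"
  shows "poly_act scale u (eigenprojector a) m = m"
  using prime_gt_1_nat[OF p]
  by (simp add: poly_act_eigenvector[OF m] eigenprojector_def power_0_left)

end

section \<open>Toral elements and automorphisms of tori\<close>

locale fd_restricted_lie_algebra =
  restricted_lie_algebra scale br pmap + finite_dimensional_vector_space scale Basis
  for scale :: "'k::alg_closed_field \<Rightarrow> 'g::ab_group_add \<Rightarrow> 'g"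
    and br :: "'g \<Rightarrow> 'g \<Rightarrow> 'g" and pmap :: "'g \<Rightarrow> 'g" and Basis :: "'g set"
begin

lemma prime_char: "prime CHAR('k)"
  using prime_CHAR_semidom[where 'a = 'k] char_pos by simp

lemma br_zero_left: "br 0 x = 0"
  using br_scale_left[of 0 0 x] by simp

lemma br_zero_right: "br x 0 = 0"
  using br_scale_right[of x 0 0] by simp

lemma pmap_zero: "pmap 0 = 0"
  using pmap_scale[of 0 0] prime_gt_0_nat[OF prime_char] by (simp add: power_0_left)

text \<open>
  The first of the \<open>p - 1 \<ge> 1\<close> applications of \<open>ad(x \<otimes> T + y \<otimes> 1)\<close> already kills \<open>x \<otimes> 1\<close>.
\<close>
lemma jacobson_commuting:
  assumes "br y x = 0"
  shows "jacobson i x y = 0"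
proof -
  have zero: "ad_poly x y 0 = 0"
    by (simp add: ad_poly_def)
  have "(ad_poly x y ^^ Suc n) [:x:] = 0" for n
  proof (induction n)
    case 0
    show ?case
      using assms by (simp add: ad_poly_def map_poly_pCons br_self br_zero_right)
  next
    case (Suc n)
    then show ?case
      using zero by simp
  qed
  moreover have "CHAR('k) - 1 = Suc (CHAR('k) - 2)"
    using prime_gt_1_nat[OF prime_char] by simp
  ultimately show ?thesis
    unfolding jacobson_def by (metis coeff_0 scale_zero_right)
qed

lemma pmap_add_commuting:
  assumes "br y x = 0"
  shows "pmap (x + y) = pmap x + pmap y"
  unfolding pmap_add by (simp add: jacobson_commuting[OF assms])

definition toral :: "'g set \<Rightarrow> 'g set" where
  "toral t = {h \<in> t. pmap h = h}"

lemma torusD: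
  assumes "torus t"
  shows "subspace t" "x \<in> t \<Longrightarrow> pmap x \<in> t" "x \<in> t \<Longrightarrow> y \<in> t \<Longrightarrow> br x y = 0"
    "x \<in> t \<Longrightarrow> semisimple x"
  using assms by (auto simp: torus_def p_subalgebra_def)

lemma semisimple_pmap_eq_0:
  assumes "semisimple x" "pmap x = 0"
  shows "x = 0"
proof -
  have "p_subalgebra {0}"
    by (auto simp: p_subalgebra_def subspace_def br_zero_left pmap_zero)
  then have "p_subalgebra hull {0} \<subseteq> {0}"
    by (intro hull_minimal) auto
  then show ?thesis
    using assms by (auto simp: semisimple_def)
qed

text \<open>
  Semisimplicity enters through injectivity of the \<open>p\<close>-map.
\<close>
lemma frobenius_semilinear_torus:
  assumes t: "torus t"
  shows "frobenius_semilinear scale Basis t pmap"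
proof
  show "subspace t"
    by (rule torusD[OF t])
  show "CHAR('k) > 1"
    by (rule prime_gt_1_nat[OF prime_char])
qed (auto simp: torusD[OF t] pmap_add_commuting pmap_scale intro: semisimple_pmap_eq_0 torusD[OF t])

lemma span_toral:
  assumes t: "torus t"
  shows "span (toral t) = t"
  using frobenius_semilinear.span_fixed[OF frobenius_semilinear_torus[OF t]]
  by (simp add: frobenius_semilinear.fixed_def[OF frobenius_semilinear_torus[OF t]] toral_def)

lemma obtain_toral_spanning_list:
  assumes t: "torus t"
  obtains hs where "set hs \<subseteq> toral t" "span (set hs) = t"
proof -
  obtain B where B: "B \<subseteq> toral t" "independent B" "toral t \<subseteq> span B"
    using maximal_independent_subset .
  obtain hs where "set hs = B"
    using finite_list finiteI_independent[OF B(2)] by blast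
  moreover have "span B = span (toral t)"
    using B(1,3) by (intro antisym span_mono span_minimal) auto
  ultimately show ?thesis
    using that[of hs] B(1) span_toral[OF t] by simp
qed

lemma toral_charactersD:
  assumes "f \<in> toral_characters t"
  shows "x \<in> t \<Longrightarrow> y \<in> t \<Longrightarrow> f (x + y) = f x + f y" "x \<in> t \<Longrightarrow> f (scale c x) = c * f x"
    "x \<notin> t \<Longrightarrow> f x = 0" "x \<in> t \<Longrightarrow> f (pmap x) = f x ^ CHAR('k)"
    "x \<in> toral t \<Longrightarrow> f x ^ CHAR('k) = f x"
proof -
  show *: "x \<in> t \<Longrightarrow> y \<in> t \<Longrightarrow> f (x + y) = f x + f y" "x \<in> t \<Longrightarrow> f (scale c x) = c * f x"
    "x \<notin> t \<Longrightarrow> f x = 0" "x \<in> t \<Longrightarrow> f (pmap x) = f x ^ CHAR('k)"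
    using assms by (auto simp: toral_characters_def Hom_on_def linear_map_on_def)
  then show "x \<in> toral t \<Longrightarrow> f x ^ CHAR('k) = f x"
    by (simp add: toral_def)
qed

lemma torus_embeddingsD:
  assumes "\<phi> \<in> torus_embeddings t"
  shows "x \<in> t \<Longrightarrow> y \<in> t \<Longrightarrow> \<phi> (x + y) = \<phi> x + \<phi> y" "x \<in> t \<Longrightarrow> \<phi> (scale c x) = scale c (\<phi> x)"
    "x \<in> t \<Longrightarrow> y \<in> t \<Longrightarrow> br (\<phi> x) (\<phi> y) = \<phi> (br x y)" "x \<in> t \<Longrightarrow> pmap (\<phi> x) = \<phi> (pmap x)"
  using assms by (auto simp: torus_embeddings_def Hom_on_def linear_map_on_def)

lemma toral_character_nonzero_on_toral:
  assumes t: "torus t" and f: "f \<in> toral_characters t" "f \<noteq> 0"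
  shows "\<exists>h \<in> toral t. f h \<noteq> 0"
proof (rule ccontr)
  assume *: "\<not> ?thesis"
  have sub: "span (toral t) \<subseteq> {x \<in> t. f x = 0}"
  proof (rule span_minimal)
    have "0 \<in> t"
      using torusD(1)[OF t] by (rule subspace_0)
    then have "f 0 = 0"
      using toral_charactersD(2)[OF f(1), of 0 0] by simp
    then show "subspace {x \<in> t. f x = 0}"
      using torusD(1)[OF t] by (auto simp: subspace_def toral_charactersD[OF f(1)])
    show "toral t \<subseteq> {x \<in> t. f x = 0}"
      using * by (auto simp: toral_def)
  qed
  have "f x = 0" for x
    using sub toral_charactersD(3)[OF f(1)] span_toral[OF t] by (cases "x \<in> t") auto
  then show False
    using f(2) by auto
qed

text \<open>
  A group is not the union of two proper subgroups. Values of \<open>f\<close> at toral elements lie in the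
  prime field, so dividing by \<open>f h\<close> keeps \<open>h\<close> toral.
\<close>
lemma common_toral_element:
  assumes t: "torus t" and f: "f \<in> toral_characters t" "f \<noteq> 0" and g: "g \<in> toral_characters t" "g \<noteq> 0"
  shows "\<exists>h \<in> toral t. f h = 1 \<and> g h \<noteq> 0"
proof -
  obtain x y where xy: "x \<in> toral t" "f x \<noteq> 0" "y \<in> toral t" "g y \<noteq> 0"
    using toral_character_nonzero_on_toral[OF t f] toral_character_nonzero_on_toral[OF t g] by blast
  then have t_xy: "x \<in> t" "y \<in> t"
    by (auto simp: toral_def)
  have "\<exists>h \<in> toral t. f h \<noteq> 0 \<and> g h \<noteq> 0"
  proof (cases "g x = 0 \<and> f y = 0")
    case True
    have "x + y \<in> toral t"
      using xy torusD(3)[OF t t_xy(2,1)] subspace_add[OF torusD(1)[OF t] t_xy]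
      by (simp add: toral_def pmap_add_commuting)
    moreover have "f (x + y) = f x" "g (x + y) = g y"
      using True toral_charactersD(1)[OF f(1) t_xy] toral_charactersD(1)[OF g(1) t_xy] by auto
    ultimately show ?thesis
      using xy by (intro bexI[of _ "x + y"]) auto
  next
    case False
    then show ?thesis
      using xy by blast
  qed
  then obtain h where h: "h \<in> toral t" "f h \<noteq> 0" "g h \<noteq> 0"
    by blast
  then have ht: "h \<in> t" "pmap h = h"
    by (auto simp: toral_def)
  have "scale (inverse (f h)) h \<in> toral t"
    using ht toral_charactersD(5)[OF f(1) h(1)] subspace_scale[OF torusD(1)[OF t] ht(1)]
    by (simp add: toral_def pmap_scale power_inverse)
  then show ?thesis
    using h ht by (intro bexI[of _ "scale (inverse (f h)) h"])
      (auto simp: toral_charactersD(2)[OF f(1)] toral_charactersD(2)[OF g(1)])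
qed

text \<open>
  For \<open>g = f + e\<close> this is \<open>x \<mapsto> x + e(x) h\<close>, a transvection in the usual sense if \<open>e h = 0\<close>; the
  condition \<open>g h \<noteq> 0\<close> makes it bijective if \<open>f h = 1\<close>. As a map on \<open>t\<close> it is extended by \<open>0\<close>.
\<close>
definition transvection :: "'g set \<Rightarrow> ('g \<Rightarrow> 'k) \<Rightarrow> ('g \<Rightarrow> 'k) \<Rightarrow> 'g \<Rightarrow> 'g \<Rightarrow> 'g" where
  "transvection t f g h = (\<lambda>x. if x \<in> t then x + scale (g x - f x) h else 0)"

context
  fixes t f g h
  assumes t: "torus t" and f: "f \<in> toral_characters t" and g: "g \<in> toral_characters t"
    and h: "h \<in> toral t" "f h = 1" "g h \<noteq> 0"
begin

private lemma ht: "h \<in> t" "pmap h = h"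
  using h by (auto simp: toral_def)

private lemma sub [simp]: "x \<in> t \<Longrightarrow> y \<in> t \<Longrightarrow> x + y \<in> t" "x \<in> t \<Longrightarrow> y \<in> t \<Longrightarrow> x - y \<in> t"
  "x \<in> t \<Longrightarrow> scale c x \<in> t"
  using torusD(1)[OF t] by (auto intro: subspace_add subspace_diff subspace_scale)

private lemmas fD = toral_charactersD[OF f] and gD = toral_charactersD[OF g]

private lemma diff: "x \<in> t \<Longrightarrow> y \<in> t \<Longrightarrow> f (x - y) = f x - f y" "x \<in> t \<Longrightarrow> y \<in> t \<Longrightarrow> g (x - y) = g x - g y"
  using fD(1)[of "x - y" y] gD(1)[of "x - y" y] by (auto simp: algebra_simps)

lemma transvection_in: "x \<in> t \<Longrightarrow> transvection t f g h x \<in> t"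
  by (simp add: transvection_def ht)

lemma character_transvection: "x \<in> t \<Longrightarrow> f (transvection t f g h x) = g x"
  by (simp add: transvection_def ht h fD)

lemma image_transvection: "transvection t f g h ` t = t"
proof
  show "t \<subseteq> transvection t f g h ` t"
  proof
    fix y assume y: "y \<in> t"
    \<comment> \<open>The preimage has the form \<open>y - c h\<close>, and applying \<open>g\<close> determines \<open>c\<close>.\<close>
    define c where "c = (g y - f y) / g h"
    have c: "c * g h = g y - f y"
      using h by (simp add: c_def)
    have "transvection t f g h (y - scale c h) = y"
      using y ht by (simp add: transvection_def diff fD gD h c)
    then show "y \<in> transvection t f g h ` t"
      using y ht by (metis image_eqI sub(2,3))
  qed
qed (auto intro: transvection_in)

lemma inj_on_transvection: "inj_on (transvection t f g h) t"
proof (rule inj_onI)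
  fix x y assume xy: "x \<in> t" "y \<in> t" and eq: "transvection t f g h x = transvection t f g h y"
  have gxy: "g x = g y"
    using character_transvection[OF xy(1)] character_transvection[OF xy(2)] eq by simp
  then have *: "x - y = scale (f x - f y) h"
    using eq xy by (simp add: transvection_def scale_left_diff_distrib algebra_simps)
  have "0 = g (x - y)"
    by (simp add: diff xy gxy)
  also have "\<dots> = (f x - f y) * g h"
    unfolding * by (rule gD(2)[OF ht(1)])
  finally show "x = y"
    using h * by simp
qed

lemma transvection_embedding: "transvection t f g h \<in> torus_embeddings t"
proof -
  have p: "(a - b) ^ CHAR('k) = a ^ CHAR('k) - b ^ CHAR('k)" for a b :: 'k
    using freshmans_dream[OF prime_char refl, of "a - b" b] by simp
  have "pmap (transvection t f g h x) = transvection t f g h (pmap x)" if "x \<in> t" for x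
    using that ht torusD(2,3)[OF t]
    by (simp add: transvection_def pmap_add_commuting pmap_scale fD gD p)
  moreover have "transvection t f g h (br x y) = br (transvection t f g h x) (transvection t f g h y)"
    if "x \<in> t" "y \<in> t" for x y
  proof -
    have "0 \<in> t"
      using torusD(1)[OF t] by (rule subspace_0)
    then have "transvection t f g h 0 = 0"
      using fD(2)[of 0 0] gD(2)[of 0 0] by (simp add: transvection_def)
    then show ?thesis
      using that torusD(3)[OF t] transvection_in by simp
  qed
  moreover have "transvection t f g h \<in> Hom_on scale scale t"
    by (auto simp: Hom_on_def linear_map_on_def transvection_def fD gD algebra_simps
        scale_left_diff_distrib scale_left_distrib scale_right_diff_distrib scale_right_distrib)
  ultimately show ?thesis
    using inj_on_transvection by (auto simp: torus_embeddings_def)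
qed

end

definition inclusion :: "'g set \<Rightarrow> 'g \<Rightarrow> 'g" where
  "inclusion t = (\<lambda>x. if x \<in> t then x else 0)"

lemma inclusion_embedding:
  assumes t: "torus t"
  shows "inclusion t \<in> torus_embeddings t"
  using torusD[OF t] subspace_0[OF torusD(1)[OF t]]
  by (auto simp: torus_embeddings_def inclusion_def Hom_on_def linear_map_on_def inj_on_def
      subspace_add subspace_scale)

end

section \<open>Weight spaces relative to an embedded torus\<close>

locale fd_restricted_lie_module =
  restricted_lie_module scale br pmap scaleM act + fd_restricted_lie_algebra scale br pmap Basis +
  M: finite_dimensional_vector_space scaleM BasisM
  for scale :: "'k::alg_closed_field \<Rightarrow> 'g::ab_group_add \<Rightarrow> 'g"
    and br :: "'g \<Rightarrow> 'g \<Rightarrow> 'g" and pmap :: "'g \<Rightarrow> 'g" and Basis :: "'g set"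
    and scaleM :: "'k \<Rightarrow> 'm::ab_group_add \<Rightarrow> 'm" and BasisM :: "'m set"
    and act :: "'g \<Rightarrow> 'm \<Rightarrow> 'm"
begin

lemma endomorphism_act: "endomorphism scaleM (act x)"
  by unfold_locales (simp_all add: act_add_right act_scale_right)

lemma act_zero_left [simp]: "act 0 m = 0"
  using act_scale_left[of 0 0 m] by simp

lemma act_zero_right [simp]: "act x 0 = 0"
  using act_scale_right[of x 0 0] by simp

lemma act_commute:
  assumes "br x y = 0"
  shows "act x (act y m) = act y (act x m)"
  using act_br[of x y m] assms by simp

text \<open>
  In coordinates with respect to a basis of \<open>M\<close>, the matrix entries of \<open>\<phi>(x)\<close> are linear in \<open>\<phi>\<close>.
\<close>
lemma polynomial_map_act:
  assumes f: "polynomial_map (fun_scale scale) V scaleM f"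
  shows "polynomial_map (fun_scale scale) V scaleM (\<lambda>\<phi>. act (\<phi> x) (f \<phi>))"
  unfolding polynomial_map_def
proof (intro allI impI)
  fix l assume l: "Vector_Spaces.linear scaleM (*) l"
  let ?r = "M.representation BasisM"
  have "l (act (\<phi> x) (f \<phi>)) = (\<Sum>b\<in>BasisM. ?r (f \<phi>) b * l (act (\<phi> x) b))" for \<phi>
  proof -
    have "f \<phi> = (\<Sum>b\<in>BasisM. scaleM (?r (f \<phi>) b) b)"
      using M.sum_representation_eq[of BasisM "f \<phi>" BasisM] M.independent_Basis M.span_Basis
        M.finite_Basis by simp
    then have "act (\<phi> x) (f \<phi>) = act (\<phi> x) (\<Sum>b\<in>BasisM. scaleM (?r (f \<phi>) b) b)"
      by simp
    also have "\<dots> = (\<Sum>b\<in>BasisM. scaleM (?r (f \<phi>) b) (act (\<phi> x) b))"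
      using sum_comp_morphism[of "act (\<phi> x)" "\<lambda>b. scaleM (?r (f \<phi>) b) b" BasisM]
      by (simp add: o_def act_add_right act_scale_right)
    finally show ?thesis
      by (simp add: M.linear_form_simps[OF l])
  qed
  moreover have "(\<lambda>\<phi>. \<Sum>b\<in>BasisM. ?r (f \<phi>) b * l (act (\<phi> x) b))
      \<in> polynomial_functions (fun_scale scale) V"
  proof (intro polynomial_functions_sum polynomial_functions.mult)
    fix b
    show "(\<lambda>\<phi>. ?r (f \<phi>) b) \<in> polynomial_functions (fun_scale scale) V"
      using polynomial_mapD[OF f M.linear_representation[OF M.independent_Basis M.span_Basis]] .
    show "(\<lambda>\<phi>. l (act (\<phi> x) b)) \<in> polynomial_functions (fun_scale scale) V"
      by (intro polynomial_functions.linear)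
        (simp add: linear_map_on_def fun_scale_def act_add_left act_scale_left M.linear_form_simps[OF l])
  qed
  ultimately show "(\<lambda>\<phi>. l (act (\<phi> x) (f \<phi>))) \<in> polynomial_functions (fun_scale scale) V"
    by simp
qed

lemma polynomial_map_poly_act:
  assumes f: "polynomial_map (fun_scale scale) V scaleM f"
  shows "polynomial_map (fun_scale scale) V scaleM (\<lambda>\<phi>. poly_act scaleM (act (\<phi> x)) q (f \<phi>))"
proof (induction q)
  case 0
  show ?case
    using M.polynomial_map_const by (simp add: endomorphism.poly_act_0[OF endomorphism_act])
next
  case (pCons c q)
  then show ?case
    unfolding endomorphism.poly_act_pCons[OF endomorphism_act]
    by (intro M.polynomial_map_add M.polynomial_map_scale polynomial_map_act f
        polynomial_functions.const)
qed

definition twisted_weight_space :: "'g set \<Rightarrow> ('g \<Rightarrow> 'g) \<Rightarrow> ('g \<Rightarrow> 'k) \<Rightarrow> 'm set" where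
  "twisted_weight_space S \<phi> f = {m. \<forall>x\<in>S. act (\<phi> x) m = scaleM (f x) m}"

definition weight_projector :: "'g list \<Rightarrow> ('g \<Rightarrow> 'k) \<Rightarrow> ('g \<Rightarrow> 'g) \<Rightarrow> 'm \<Rightarrow> 'm" where
  "weight_projector hs f \<phi> = foldr (\<lambda>h. poly_act scaleM (act (\<phi> h)) (eigenprojector (f h))) hs"

lemma weight_projector_simps [simp]:
  "weight_projector [] f \<phi> m = m"
  "weight_projector (h # hs) f \<phi> m =
     poly_act scaleM (act (\<phi> h)) (eigenprojector (f h)) (weight_projector hs f \<phi> m)"
  by (simp_all add: weight_projector_def)

lemma polynomial_map_weight_projector:
  "polynomial_map (fun_scale scale) V scaleM (\<lambda>\<phi>. weight_projector hs f \<phi> m)"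
  by (induction hs) (simp_all add: polynomial_map_poly_act M.polynomial_map_const)

lemma linear_weight_projector:
  "Vector_Spaces.linear scaleM scaleM (weight_projector hs f \<phi>)"
proof -
  have "weight_projector hs f \<phi> (m + n) = weight_projector hs f \<phi> m + weight_projector hs f \<phi> n"
    "weight_projector hs f \<phi> (scaleM c m) = scaleM c (weight_projector hs f \<phi> m)" for c m n
    by (induction hs) (simp_all add: endomorphism.poly_act_add_right[OF endomorphism_act]
        endomorphism.poly_act_scale_right[OF endomorphism_act])
  then show ?thesis
    by unfold_locales
qed

context
  fixes t \<phi> f
  assumes t: "torus t" and \<phi>: "\<phi> \<in> torus_embeddings t" and f: "f \<in> toral_characters t"
begin

private lemma act_embedding_commute:
  assumes "x \<in> t" "y \<in> t"
  shows "act (\<phi> x) (act (\<phi> y) m) = act (\<phi> y) (act (\<phi> x) m)"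
proof (rule act_commute)
  have "0 \<in> t"
    using torusD(1)[OF t] by (rule subspace_0)
  then have "\<phi> 0 = 0"
    using torus_embeddingsD(2)[OF \<phi>, of 0 0] by simp
  then show "br (\<phi> x) (\<phi> y) = 0"
    using torus_embeddingsD(3)[OF \<phi> assms] torusD(3)[OF t assms] by simp
qed

private lemma act_embedding_toral:
  assumes "h \<in> toral t"
  shows "act (\<phi> h) ^^ CHAR('k) = act (\<phi> h)"
  using act_pmap[of "\<phi> h"] torus_embeddingsD(4)[OF \<phi>, of h] assms by (simp add: toral_def)

text \<open>
  The factor for \<open>h\<close> projects to an eigenspace of \<open>\<phi>(h)\<close> and, commuting with the action of the other
  toral elements, preserves the eigenspaces reached before.
\<close>
lemma weight_projector_in:
  assumes "set hs \<subseteq> toral t"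
  shows "weight_projector hs f \<phi> m \<in> twisted_weight_space (set hs) \<phi> f"
  using assms
proof (induction hs)
  case Nil
  show ?case
    by (simp add: twisted_weight_space_def)
next
  case (Cons h hs)
  interpret u: endomorphism scaleM "act (\<phi> h)"
    by (rule endomorphism_act)
  let ?n = "weight_projector hs f \<phi> m"
  let ?e = "poly_act scaleM (act (\<phi> h)) (eigenprojector (f h))"
  have h: "h \<in> toral t" "h \<in> t"
    using Cons.prems by (auto simp: toral_def)
  have "act (\<phi> h) (?e ?n) = scaleM (f h) (?e ?n)"
    by (intro u.eigenprojector_eigenvector prime_char act_embedding_toral h toral_charactersD(5)[OF f])
  moreover have "act (\<phi> x) (?e ?n) = scaleM (f x) (?e ?n)" if x: "x \<in> set hs" for x
  proof -
    have "x \<in> t"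
      using x Cons.prems by (auto simp: toral_def)
    then have "act (\<phi> x) (?e ?n) = ?e (act (\<phi> x) ?n)"
      by (intro u.poly_act_commute act_add_right act_scale_right act_embedding_commute h)
    also have "act (\<phi> x) ?n = scaleM (f x) ?n"
      using Cons x by (simp add: twisted_weight_space_def)
    finally show ?thesis
      by (simp add: u.poly_act_scale_right)
  qed
  ultimately show ?case
    by (simp add: twisted_weight_space_def)
qed

lemma weight_projector_id:
  assumes "m \<in> twisted_weight_space (set hs) \<phi> f"
  shows "weight_projector hs f \<phi> m = m"
  using assms
  by (induction hs)
     (simp_all add: twisted_weight_space_def prime_char
        endomorphism.eigenprojector_id[OF endomorphism_act])

lemma twisted_weight_space_spanning:
  assumes "span S = t"
  shows "twisted_weight_space S \<phi> f = twisted_weight_space t \<phi> f"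
proof
  show "twisted_weight_space t \<phi> f \<subseteq> twisted_weight_space S \<phi> f"
    using span_superset[of S] assms by (auto simp: twisted_weight_space_def)
  show "twisted_weight_space S \<phi> f \<subseteq> twisted_weight_space t \<phi> f"
  proof
    fix m assume m: "m \<in> twisted_weight_space S \<phi> f"
    have "span S \<subseteq> {x \<in> t. act (\<phi> x) m = scaleM (f x) m}"
    proof (rule span_minimal)
      show "S \<subseteq> {x \<in> t. act (\<phi> x) m = scaleM (f x) m}"
        using m span_superset[of S] assms by (auto simp: twisted_weight_space_def)
      have "0 \<in> t"
        using torusD(1)[OF t] by (rule subspace_0)
      then have "\<phi> 0 = 0" "f 0 = 0"
        using torus_embeddingsD(2)[OF \<phi>, of 0 0] toral_charactersD(2)[OF f, of 0 0] by auto
      then show "subspace {x \<in> t. act (\<phi> x) m = scaleM (f x) m}"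
        using torusD(1)[OF t]
        by (auto simp: subspace_def torus_embeddingsD[OF \<phi>] toral_charactersD[OF f]
            act_add_left act_scale_left M.scale_left_distrib)
    qed
    then show "m \<in> twisted_weight_space t \<phi> f"
      using assms by (auto simp: twisted_weight_space_def)
  qed
qed

lemma range_weight_projector:
  assumes "set hs \<subseteq> toral t" "span (set hs) = t"
  shows "range (weight_projector hs f \<phi>) = twisted_weight_space t \<phi> f"
  unfolding twisted_weight_space_spanning[OF assms(2), symmetric]
  using weight_projector_in[OF assms(1)] weight_projector_id
  by (metis (no_types, lifting) image_subset_iff rangeI subsetI subset_antisym)

end

lemma dim_twisted_weight_space_const:
  assumes irr: "irreducible_space (torus_embedding_variety t)" and t: "torus t"
    and f: "f \<in> toral_characters t"
    and \<phi>: "\<phi> \<in> torus_embeddings t" and \<psi>: "\<psi> \<in> torus_embeddings t"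
  shows "M.dim (twisted_weight_space t \<phi> f) = M.dim (twisted_weight_space t \<psi> f)"
proof -
  obtain hs where hs: "set hs \<subseteq> toral t" "span (set hs) = t"
    using obtain_toral_spanning_list[OF t] .
  let ?V = "Hom_on scale scale t"
  let ?P = "weight_projector hs f"
  have emb: "\<theta> \<in> ?V \<inter> torus_embeddings t \<longleftrightarrow> \<theta> \<in> torus_embeddings t" for \<theta>
    by (auto simp: torus_embeddings_def)
  have "M.dim (range (?P \<phi>)) = M.dim (range (?P \<psi>))"
  proof (rule M.rank_idempotent_family_const[where P = ?P and x = \<phi> and y = \<psi>,
        OF irr[unfolded torus_embedding_variety_def]])
    fix \<theta> m assume "\<theta> \<in> ?V \<inter> torus_embeddings t"
    then show "?P \<theta> (?P \<theta> m) = ?P \<theta> m"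
      using weight_projector_id[OF t _ f weight_projector_in[OF t _ f hs(1)]] emb by blast
  qed (use \<phi> \<psi> emb polynomial_map_weight_projector linear_weight_projector in blast)+
  then show ?thesis
    by (simp add: range_weight_projector[OF t _ f hs] \<phi> \<psi>)
qed

lemma twisted_weight_space_inclusion:
  "twisted_weight_space t (inclusion t) f = weight_space t f"
  by (simp add: twisted_weight_space_def weight_space_def inclusion_def)

text \<open>
  The weight space of \<open>g\<close> relative to the embedding \<open>\<tau>\<close> with \<open>f \<circ> \<tau> = g\<close> is the weight space of \<open>f\<close>.
\<close>
lemma dim_weight_space_eq:
  assumes irr: "irreducible_space (torus_embedding_variety t)" and t: "torus t"
    and f: "f \<in> toral_characters t" "f \<noteq> 0" and g: "g \<in> toral_characters t" "g \<noteq> 0"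
  shows "M.dim (weight_space t f) = M.dim (weight_space t g)"
proof -
  obtain h where h: "h \<in> toral t" "f h = 1" "g h \<noteq> 0"
    using common_toral_element[OF t f g] by blast
  let ?\<tau> = "transvection t f g h"
  have "m \<in> twisted_weight_space t ?\<tau> g \<longleftrightarrow> m \<in> weight_space t f" for m
  proof -
    have "m \<in> twisted_weight_space t ?\<tau> g \<longleftrightarrow>
        (\<forall>x\<in>t. act (?\<tau> x) m = scaleM (f (?\<tau> x)) m)"
      by (simp add: twisted_weight_space_def character_transvection[OF t f(1) g(1) h])
    also have "\<dots> \<longleftrightarrow> (\<forall>y \<in> ?\<tau> ` t. act y m = scaleM (f y) m)"
      by blast
    finally show ?thesis
      unfolding image_transvection[OF t f(1) g(1) h] by (simp add: weight_space_def)
  qed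
  then have "twisted_weight_space t ?\<tau> g = weight_space t f"
    by blast
  then show ?thesis
    using dim_twisted_weight_space_const[OF irr t g(1) transvection_embedding[OF t f(1) g(1) h]
        inclusion_embedding[OF t]] by (simp add: twisted_weight_space_inclusion)
qed

section \<open>Weights of the module\<close>

lemma weight_iff: "f \<in> weights t \<longleftrightarrow> f \<in> Hom_on scale (*) t \<and> (\<exists>m \<in> weight_space t f. m \<noteq> 0)"
proof -
  have "0 \<in> weight_space t f"
    by (simp add: weight_space_def)
  then show ?thesis
    unfolding weights_def by blast
qed

lemma weights_subset_toral_characters:
  assumes t: "torus t"
  shows "weights t \<subseteq> toral_characters t"
proof
  fix f assume f: "f \<in> weights t"
  then obtain m where m: "m \<in> weight_space t f" "m \<noteq> 0"
    using weight_iff by blast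
  have "f (pmap x) = f x ^ CHAR('k)" if x: "x \<in> t" for x
  proof -
    interpret u: endomorphism scaleM "act x"
      by (rule endomorphism_act)
    have "scaleM (f (pmap x)) m = act (pmap x) m"
      using m x torusD(2)[OF t] by (simp add: weight_space_def)
    also have "\<dots> = scaleM (f x ^ CHAR('k)) m"
      unfolding act_pmap using m x by (intro u.funpow_eigenvector) (simp add: weight_space_def)
    finally show ?thesis
      using m(2) by simp
  qed
  then show "f \<in> toral_characters t"
    using f by (simp add: toral_characters_def weights_def)
qed

text \<open>
  Every toral element \<open>h\<close> is annihilated on \<open>M\<close> by \<open>X\<^sup>p - X\<close>, so a common eigenvector of the elements treated
  before can be replaced by one that is an eigenvector of \<open>h\<close> as well.
\<close>
lemma exists_common_eigenvector:
  assumes t: "torus t" and m0: "(m0 :: 'm) \<noteq> 0" and hs: "set hs \<subseteq> toral t"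
  shows "\<exists>m. m \<noteq> 0 \<and> (\<forall>h\<in>set hs. \<exists>a. act h m = scaleM a m)"
  using hs
proof (induction hs)
  case Nil
  show ?case
    using m0 by auto
next
  case (Cons h hs)
  interpret u: endomorphism scaleM "act h"
    by (rule endomorphism_act)
  obtain m where m: "m \<noteq> 0" "\<And>x. x \<in> set hs \<Longrightarrow> \<exists>a. act x m = scaleM a m"
    using Cons by auto
  have h: "h \<in> t" "pmap h = h"
    using Cons.prems by (auto simp: toral_def)
  let ?q = "monom 1 CHAR('k) - monom 1 1 :: 'k poly"
  have "coeff ?q CHAR('k) = 1"
    using prime_gt_1_nat[OF prime_char] by simp
  then have "?q \<noteq> 0"
    by (metis coeff_0 zero_neq_one)
  moreover have "poly_act scaleM (act h) ?q m = 0"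
    unfolding u.poly_act_diff u.poly_act_monom using act_pmap[of h] h(2) by simp
  ultimately obtain r a where r: "poly_act scaleM (act h) r m \<noteq> 0"
      "act h (poly_act scaleM (act h) r m) = scaleM a (poly_act scaleM (act h) r m)"
    using exists_eigenvector_poly_act[OF endomorphism_act _ _ m(1)] by blast
  have "\<exists>a. act x (poly_act scaleM (act h) r m) = scaleM a (poly_act scaleM (act h) r m)"
    if x: "x \<in> set hs" for x
  proof -
    have "x \<in> t"
      using x Cons.prems by (auto simp: toral_def)
    then have "act x (poly_act scaleM (act h) r m) = poly_act scaleM (act h) r (act x m)"
      by (intro u.poly_act_commute act_add_right act_scale_right act_commute torusD(3)[OF t] h)
    moreover obtain b where "act x m = scaleM b m"
      using m(2)[OF x] by blast
    ultimately show ?thesis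
      using u.poly_act_scale_right by auto
  qed
  then show ?case
    using r by auto
qed

text \<open>
  The eigenvalues of a common eigenvector form a linear form because the vector is non-zero.
\<close>
lemma weights_nonempty:
  assumes t: "torus t" and m0: "(m0 :: 'm) \<noteq> 0"
  shows "weights t \<noteq> {}"
proof -
  obtain hs where hs: "set hs \<subseteq> toral t" "span (set hs) = t"
    using obtain_toral_spanning_list[OF t] .
  obtain m where m: "m \<noteq> 0" "\<And>h. h \<in> set hs \<Longrightarrow> \<exists>a. act h m = scaleM a m"
    using exists_common_eigenvector[OF t m0 hs(1)] by blast
  have "span (set hs) \<subseteq> {x. \<exists>a. act x m = scaleM a m}"
  proof (rule span_minimal)
    have "\<exists>a. act (x + y) m = scaleM a m" if "act x m = scaleM a m" "act y m = scaleM b m" for x y a b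
      using that by (intro exI[of _ "a + b"]) (simp add: act_add_left M.scale_left_distrib)
    moreover have "\<exists>a. act (scale c x) m = scaleM a m" if "act x m = scaleM a m" for x a c
      using that by (intro exI[of _ "c * a"]) (simp add: act_scale_left)
    moreover have "\<exists>a. act 0 m = scaleM a m"
      by (intro exI[of _ 0]) simp
    ultimately show "subspace {x. \<exists>a. act x m = scaleM a m}"
      unfolding subspace_def by blast
  qed (use m in blast)
  then have "\<forall>x\<in>t. \<exists>a. act x m = scaleM a m"
    using hs(2) by blast
  then obtain a where a: "\<And>x. x \<in> t \<Longrightarrow> act x m = scaleM (a x) m"
    by metis
  define f where "f x = (if x \<in> t then a x else 0)" for x
  have f: "act x m = scaleM (f x) m" if "x \<in> t" for x
    using a that by (simp add: f_def)
  have "f (x + y) = f x + f y" if "x \<in> t" "y \<in> t" for x y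
  proof -
    have "scaleM (f (x + y)) m = scaleM (f x + f y) m"
      using that subspace_add[OF torusD(1)[OF t] that]
      by (simp add: f[symmetric] act_add_left M.scale_left_distrib)
    then show ?thesis
      using m(1) by simp
  qed
  moreover have "f (scale c x) = c * f x" if "x \<in> t" for c x
  proof -
    have "scaleM (f (scale c x)) m = scaleM c (act x m)"
      using that subspace_scale[OF torusD(1)[OF t] that] by (simp add: f[symmetric] act_scale_left)
    then have "scaleM (f (scale c x)) m = scaleM (c * f x) m"
      using f[OF that] by simp
    then show ?thesis
      using m(1) by simp
  qed
  ultimately have "f \<in> Hom_on scale (*) t"
    by (simp add: Hom_on_def linear_map_on_def f_def)
  then have "f \<in> weights t"
    using f m(1) by (auto simp: weight_iff weight_space_def)
  then show ?thesis
    by blast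
qed

end

theorem corollary6p1p2:
  fixes scale :: "'k::alg_closed_field \<Rightarrow> 'g::ab_group_add \<Rightarrow> 'g"
    and br :: "'g \<Rightarrow> 'g \<Rightarrow> 'g" and pmap :: "'g \<Rightarrow> 'g"
    and scaleM :: "'k \<Rightarrow> 'm::ab_group_add \<Rightarrow> 'm" and act :: "'g \<Rightarrow> 'm \<Rightarrow> 'm"
    and t :: "'g set"
  assumes "CHAR('k) \<ge> 3"
    and "restricted_lie_algebra scale br pmap"
    and "\<exists>B. finite_dimensional_vector_space scale B"
    and "restricted_lie_algebra.torus scale br pmap t"
    and "vector_space.dim scale t = restricted_lie_algebra.max_torus_dim scale br pmap"
    and "restricted_lie_module scale br pmap scaleM act"
    and "\<exists>B. finite_dimensional_vector_space scaleM B"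
    and "irreducible_space (restricted_lie_algebra.torus_embedding_variety scale br pmap t)"
  shows "((UNIV :: 'm set) \<noteq> {0} \<longrightarrow>
           restricted_lie_module.weights scale scaleM act t = {0} \<or>
           restricted_lie_algebra.toral_characters scale pmap t - {0}
             \<subseteq> restricted_lie_module.weights scale scaleM act t) \<and>
         (\<forall>f \<in> restricted_lie_module.weights scale scaleM act t - {0}.
          \<forall>h \<in> restricted_lie_module.weights scale scaleM act t - {0}.
            vector_space.dim scaleM (restricted_lie_module.weight_space scaleM act t f) =
            vector_space.dim scaleM (restricted_lie_module.weight_space scaleM act t h))"
proof -
  obtain BG BM where "finite_dimensional_vector_space scale BG" "finite_dimensional_vector_space scaleM BM"
    using assms(3,7) by blast
  then interpret fd_restricted_lie_module scale br pmap BG scaleM BM act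
    using assms(2,6) by (intro fd_restricted_lie_module.intro fd_restricted_lie_algebra.intro)
  note t = \<open>torus t\<close> and irr = \<open>irreducible_space (torus_embedding_variety t)\<close>
  have dim_eq: "M.dim (weight_space t f) = M.dim (weight_space t g)"
    if "f \<in> toral_characters t - {0}" "g \<in> toral_characters t - {0}" for f g
    using dim_weight_space_eq[OF irr t] that by blast
  have "toral_characters t - {0} \<subseteq> weights t" if f: "f \<in> weights t" "f \<noteq> 0" for f
  proof
    fix g assume g: "g \<in> toral_characters t - {0}"
    have "f \<in> toral_characters t - {0}"
      using f weights_subset_toral_characters[OF t] by auto
    from dim_eq[OF this g] have "M.dim (weight_space t g) = M.dim (weight_space t f)"
      by simp
    moreover have "\<not> weight_space t f \<subseteq> {0}"
      using f weight_iff by blast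
    ultimately have "\<not> weight_space t g \<subseteq> {0}"
      using M.dim_eq_0 by metis
    then show "g \<in> weights t"
      using g weight_iff by (auto simp: toral_characters_def)
  qed
  moreover have "weights t \<noteq> {}" if "(UNIV :: 'm set) \<noteq> {0}"
    using that weights_nonempty[OF t] by blast
  ultimately have "(UNIV :: 'm set) \<noteq> {0} \<longrightarrow> weights t = {0} \<or> toral_characters t - {0} \<subseteq> weights t"
    by blast
  moreover have "M.dim (weight_space t f) = M.dim (weight_space t g)"
    if "f \<in> weights t - {0}" "g \<in> weights t - {0}" for f g
    using dim_eq that weights_subset_toral_characters[OF t] by blast
  ultimately show ?thesis
    by blast
qed

end
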